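(* Let $U$ be an open subset of ${}^{\rho}\mathbb R^k$. Then the following hold. (1) There is an inclusion ${}^{\rho}C^\infty(U,{}^{\rho}\mathbb F)\to\hom_{\mathbf{Set}}(U,{}^{\rho}\mathbb F)$. (2) ${}^{\rho}C^\infty(U,{}^{\rho}\mathbb F)$ is a differential algebra over ${}^{\rho}\mathbb F$. (3) If $U$ is an open subset of $\mathbb R^k$ then there is an injection of differential algebras $i_U\colon C^\infty(U,\mathbb F)\to{}^{\rho}C^\infty({}^{\rho}U,{}^{\rho}\mathbb F)$.
   Context: $\mathbb N$ is the set of nonnegative integers, $\mathcal U$ a fixed free ultrafilter on $\mathbb N$; "$P(n)$ a.e." means $\{n: P(n)\}\in\mathcal U$. $\mathbb F$ is $\mathbb R$ or $\mathbb C$. ${}^*\mathbb F=\mathbb F^{\mathbb N}/\{(x_n): x_n=0\text{ a.e.}\}$, with $[a_n]\le[b_n]$ in ${}^*\mathbb R$ iff $a_n\le b_n$ a.e.; ${}^*\mathbb N\subset{}^*\mathbb R$ is the image of $\mathbb N^{\mathbb N}$; $\rho=[1/n]$. ${}^{\rho}\mathbf M({}^*\mathbb F)=\{x:\exists c\in{}^*\mathbb N,\ |x|\le\rho^{-c}\}$, ${}^{\rho}\mathbf N({}^*\mathbb F)=\{x:\forall d\in{}^*\mathbb N,\ |x|\le\rho^{d}\}$, ${}^{\rho}\mathbb F={}^{\rho}\mathbf M({}^*\mathbb F)/{}^{\rho}\mathbf N({}^*\mathbb F)$. ${}^{\rho}\mathbf M(\mathbb R^{\mathbb N})=\{(x_n):\exists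 (c_n)\in\mathbb N^{\mathbb N},\ |x_n|\le n^{c_n}\text{ a.e.}\}$. ${}^{\rho}\mathbb R^k$ has the topology with basis the sets $[V_n]=\{[x_n]:(x_n)\in\prod_nV_n\cap{}^{\rho}\mathbf M(\mathbb R^{\mathbb N})^k\}$, $V_n\subset\mathbb R^k$ open; for $U\subset\mathbb R^k$, ${}^{\rho}U=[V_n]$ with all $V_n=U$. Let $q\colon{}^{\rho}\mathbf M({}^*\mathbb R)\to{}^{\rho}\mathbb R$ be the projection; for $U\subset{}^{\rho}\mathbb R^k$ open put $U'=(q^k)^{-1}(U)\subset{}^{\rho}\mathbf M({}^*\mathbb R)^k$. ${}^*C^\infty(U',{}^*\mathbb F)$ is the set of $f\colon U'\to{}^*\mathbb F$ such that each $x\in U'$ has a neighbourhood $V=[V_n]\subset U'$ ($V_n$ open in $\mathbb R^k$; here classes in ${}^*\mathbb R^k$ of nets in $\prod V_n\cap{}^{\rho}\mathbf M(\mathbb R^{\mathbb N})^k$) and $C^\infty$ functions $g_n\colon V_n\to\mathbb F$ with $f([y_n])=[g_n(y_n)]$ for all $[y_n]\in V$, $y_n\in V_n$; $\partial_if([x_n])=[\partial_ig_n(x_n)]$ and $D^\alpha=\partial_1^{\alpha_1}\cdots\partial_k^{\alpha_k}$. For $\mathbf L=\mathbf M,\mathbf N$ put ${}^{\rho}\mathbf L({}^*C^\infty(U',{}^*\mathbb F))=\{\phi\in{}^*C^\infty(U',{}^*\mathbb F):\forall\alpha\in\mathbb N^k,\forall y\in U',\ D^\alpha\phi(y)\in{}^{\rho}\mathbf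 L({}^*\mathbb F)\}$ and ${}^{\rho}C^\infty(U,{}^{\rho}\mathbb F)={}^{\rho}\mathbf M({}^*C^\infty(U',{}^*\mathbb F))/{}^{\rho}\mathbf N({}^*C^\infty(U',{}^*\mathbb F))$, with derivations induced by the $\partial_i$. A differential algebra is a commutative algebra with linear operators $\partial_1,\dots,\partial_k$ satisfying the Leibniz rule and commuting with one another. *)

theory Defs
  imports "HOL-Analysis.Analysis" "HOL-Algebra.QuotRing" "HOL-Algebra.Module"
    "HOL-Decision_Procs.Algebra_Aux"
begin

text \<open>
  A set of naturals belongs to the ultrafilter iff its membership predicate holds
  eventually, so that ``\<open>P n\<close> a.e.'' is \<open>\<forall>\<^sub>F n in \<U>. P n\<close>.  The ultrafilter is a parameter of
  everything that follows.  The scalar field is a type \<open>'f\<close> of class \<^class>\<open>real_normed_field\<close>;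
  the real and the complex numbers are (up to isomorphism the only) instances.
  The index type \<open>'n\<close> plays the role of \<open>{1..k}\<close>.
\<close>

definition free_ultrafilter :: "nat filter \<Rightarrow> bool" where
  "free_ultrafilter \<U> \<longleftrightarrow> \<U> \<noteq> bot
     \<and> (\<forall>P. eventually P \<U> \<or> eventually (\<lambda>n. \<not> P n) \<U>)
     \<and> (\<forall>A. finite A \<longrightarrow> \<not> eventually (\<lambda>n. n \<in> A) \<U>)"


section \<open>Differential algebras\<close>

record ('a, 'b, 'i) dalg = "('a, 'b) module" +
  pder :: "'i \<Rightarrow> 'b \<Rightarrow> 'b"

locale differential_algebra = algebra R A
  for R (structure) and A :: "('a, 'b, 'i, 'm) dalg_scheme" (structure) +
  assumes pder_closed: "x \<in> carrier A \<Longrightarrow> pder A i x \<in> carrier A"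
    and pder_add: "\<lbrakk>x \<in> carrier A; y \<in> carrier A\<rbrakk> \<Longrightarrow>
          pder A i (x \<oplus>\<^bsub>A\<^esub> y) = pder A i x \<oplus>\<^bsub>A\<^esub> pder A i y"
    and pder_smult: "\<lbrakk>c \<in> carrier R; x \<in> carrier A\<rbrakk> \<Longrightarrow>
          pder A i (c \<odot>\<^bsub>A\<^esub> x) = c \<odot>\<^bsub>A\<^esub> pder A i x"
    and pder_Leibniz: "\<lbrakk>x \<in> carrier A; y \<in> carrier A\<rbrakk> \<Longrightarrow>
          pder A i (x \<otimes>\<^bsub>A\<^esub> y) = (pder A i x \<otimes>\<^bsub>A\<^esub> y) \<oplus>\<^bsub>A\<^esub> (x \<otimes>\<^bsub>A\<^esub> pder A i y)"
    and pder_commute: "x \<in> carrier A \<Longrightarrow> pder A i (pder A j x) = pder A j (pder A i x)"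

text \<open>
  The two algebras may have different base rings, in which case linearity is
  understood along a ring homomorphism \<open>\<sigma>\<close> between these.
\<close>

definition dalg_hom ::
  "('a, 'p) ring_scheme \<Rightarrow> ('a, 'b, 'i, 'q) dalg_scheme \<Rightarrow>
   ('c, 'r) ring_scheme \<Rightarrow> ('c, 'd, 'i, 's) dalg_scheme \<Rightarrow>
   ('a \<Rightarrow> 'c) \<Rightarrow> ('b \<Rightarrow> 'd) \<Rightarrow> bool" where
  "dalg_hom R A S B \<sigma> h \<longleftrightarrow>
     differential_algebra R A \<and> differential_algebra S B
     \<and> \<sigma> \<in> ring_hom R S \<and> h \<in> ring_hom A B
     \<and> (\<forall>c\<in>carrier R. \<forall>x\<in>carrier A. h (c \<odot>\<^bsub>A\<^esub> x) = \<sigma> c \<odot>\<^bsub>B\<^esub> h x)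
     \<and> (\<forall>i. \<forall>x\<in>carrier A. h (pder A i x) = pder B i (h x))"

definition fun_dalg ::
  "'x set \<Rightarrow> ('a, 'm) ring_scheme \<Rightarrow> ('x \<Rightarrow> 'a) set \<Rightarrow> ('i \<Rightarrow> ('x \<Rightarrow> 'a) \<Rightarrow> ('x \<Rightarrow> 'a)) \<Rightarrow>
   ('a, 'x \<Rightarrow> 'a, 'i) dalg" where
  "fun_dalg S R C D =
     \<lparr>carrier = C,
      mult = (\<lambda>f g. \<lambda>x\<in>S. f x \<otimes>\<^bsub>R\<^esub> g x),
      one = (\<lambda>x\<in>S. \<one>\<^bsub>R\<^esub>),
      zero = (\<lambda>x\<in>S. \<zero>\<^bsub>R\<^esub>),
      add = (\<lambda>f g. \<lambda>x\<in>S. f x \<oplus>\<^bsub>R\<^esub> g x),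
      smult = (\<lambda>c f. \<lambda>x\<in>S. c \<otimes>\<^bsub>R\<^esub> f x),
      pder = D\<rparr>"

text \<open>
  The quotient of \<open>A\<close> by \<open>J\<close>, as an algebra over a quotient of the base ring of \<open>A\<close>: the
  operations are those induced on representatives.  The unions are over cosets that
  all agree whenever the induced operation is well defined.
\<close>

definition quot_dalg ::
  "('a, 'b, 'i, 'm) dalg_scheme \<Rightarrow> 'b set \<Rightarrow> ('a set, 'b set, 'i) dalg" where
  "quot_dalg A J =
     \<lparr>carrier = carrier (A Quot J),
      mult = mult (A Quot J),
      one = one (A Quot J),
      zero = zero (A Quot J),
      add = add (A Quot J),
      smult = (\<lambda>C F. \<Union>c\<in>C. \<Union>f\<in>F. J +>\<^bsub>A\<^esub> (c \<odot>\<^bsub>A\<^esub> f)),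
      pder = (\<lambda>i F. \<Union>f\<in>F. J +>\<^bsub>A\<^esub> pder A i f)\<rparr>"

definition multi_pder ::
  "('a, 'b, 'i::{finite, linorder}, 'm) dalg_scheme \<Rightarrow> ('i \<Rightarrow> nat) \<Rightarrow> 'b \<Rightarrow> 'b" where
  "multi_pder A \<alpha> = foldr (\<lambda>i. pder A i ^^ \<alpha> i) (sorted_list_of_set UNIV)"


section \<open>Smooth functions on open subsets of \<open>\<real>\<^sup>k\<close>\<close>

definition partial :: "'n::finite \<Rightarrow> (real^'n \<Rightarrow> 'f::real_normed_vector) \<Rightarrow> real^'n \<Rightarrow> 'f" where
  "partial i g x = vector_derivative (\<lambda>t. g (x + t *\<^sub>R axis i 1)) (at 0)"

primrec cont_diff_on :: "nat \<Rightarrow> (real^'n::finite) set \<Rightarrow> (real^'n \<Rightarrow> 'f::real_normed_vector) \<Rightarrow> bool" where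
  "cont_diff_on 0 V g \<longleftrightarrow> continuous_on V g"
| "cont_diff_on (Suc m) V g \<longleftrightarrow> continuous_on V g \<and>
     (\<forall>i. (\<forall>x\<in>V. (\<lambda>t. g (x + t *\<^sub>R axis i 1)) differentiable (at 0)) \<and>
          cont_diff_on m V (partial i g))"

definition smooth_on :: "(real^'n::finite) set \<Rightarrow> (real^'n \<Rightarrow> 'f::real_normed_vector) \<Rightarrow> bool" where
  "smooth_on V g \<longleftrightarrow> (\<forall>m. cont_diff_on m V g)"

definition smooth_dalg :: "(real^'n::finite) set \<Rightarrow> ('f, real^'n \<Rightarrow> 'f::real_normed_field, 'n) dalg" where
  "smooth_dalg W = fun_dalg W cring_class_ops {f \<in> extensional W. smooth_on W f}
     (\<lambda>i f. \<lambda>x\<in>W. partial i f x)"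


section \<open>The field \<open>\<^sup>*\<bbbF>\<close>\<close>

type_synonym 'f star = "(nat \<Rightarrow> 'f) set"

definition seq_ring :: "(nat \<Rightarrow> 'f::real_normed_field) ring" where
  "seq_ring = \<lparr>carrier = UNIV, mult = (\<lambda>x y n. x n * y n), one = (\<lambda>n. 1),
               zero = (\<lambda>n. 0), add = (\<lambda>x y n. x n + y n)\<rparr>"

definition null_seqs :: "nat filter \<Rightarrow> (nat \<Rightarrow> 'f::real_normed_field) set" where
  "null_seqs \<U> = {x. \<forall>\<^sub>F n in \<U>. x n = 0}"

definition star_ring :: "nat filter \<Rightarrow> 'f::real_normed_field star ring" where
  "star_ring \<U> = seq_ring Quot null_seqs \<U>"

definition star_cls :: "nat filter \<Rightarrow> (nat \<Rightarrow> 'f::real_normed_field) \<Rightarrow> 'f star" where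
  "star_cls \<U> x = null_seqs \<U> +>\<^bsub>seq_ring\<^esub> x"

text \<open>
  The elements of a class \<open>X\<close> are exactly its representatives.  Below, order, absolute value and
  power are induced from the entrywise ones; the unions are over equal classes.
\<close>

definition star_le :: "nat filter \<Rightarrow> real star \<Rightarrow> real star \<Rightarrow> bool" where
  "star_le \<U> X Y \<longleftrightarrow> (\<exists>a\<in>X. \<exists>b\<in>Y. \<forall>\<^sub>F n in \<U>. a n \<le> b n)"

definition star_abs :: "nat filter \<Rightarrow> 'f::real_normed_field star \<Rightarrow> real star" where
  "star_abs \<U> X = (\<Union>x\<in>X. star_cls \<U> (\<lambda>n. norm (x n)))"

definition star_powr :: "nat filter \<Rightarrow> real star \<Rightarrow> real star \<Rightarrow> real star" where
  "star_powr \<U> X Y = (\<Union>x\<in>X. \<Union>y\<in>Y. star_cls \<U> (\<lambda>n. x n powr y n))"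

definition star_nats :: "nat filter \<Rightarrow> real star set" where
  "star_nats \<U> = range (\<lambda>c :: nat \<Rightarrow> nat. star_cls \<U> (\<lambda>n. real (c n)))"

text \<open>The entry at \<open>n = 0\<close>, here \<open>1 / 0 = 0\<close>, is irrelevant since the ultrafilter is free.\<close>

definition star_rho :: "nat filter \<Rightarrow> real star" where
  "star_rho \<U> = star_cls \<U> (\<lambda>n. 1 / real n)"


section \<open>The ring \<open>\<^sup>\<rho>\<bbbF>\<close>\<close>

text \<open>The exponents range over all of \<open>\<^sup>*\<nat>\<close>, infinite hypernaturals included.\<close>

definition star_M :: "nat filter \<Rightarrow> 'f::real_normed_field star set" where
  "star_M \<U> = {x \<in> carrier (star_ring \<U>).
     \<exists>c\<in>star_nats \<U>. star_le \<U> (star_abs \<U> x) (star_powr \<U> (star_rho \<U>) (\<ominus>\<^bsub>star_ring \<U>\<^esub> c))}"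

definition star_N :: "nat filter \<Rightarrow> 'f::real_normed_field star set" where
  "star_N \<U> = {x \<in> carrier (star_ring \<U>).
     \<forall>d\<in>star_nats \<U>. star_le \<U> (star_abs \<U> x) (star_powr \<U> (star_rho \<U>) d)}"

type_synonym 'f rho = "'f star set"

definition star_M_ring :: "nat filter \<Rightarrow> 'f::real_normed_field star ring" where
  "star_M_ring \<U> = (star_ring \<U>)\<lparr>carrier := star_M \<U>\<rparr>"

definition rho_ring :: "nat filter \<Rightarrow> 'f::real_normed_field rho ring" where
  "rho_ring \<U> = star_M_ring \<U> Quot star_N \<U>"

definition rho_proj :: "nat filter \<Rightarrow> 'f::real_normed_field star \<Rightarrow> 'f rho" where
  "rho_proj \<U> x = star_N \<U> +>\<^bsub>star_M_ring \<U>\<^esub> x"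


section \<open>The spaces \<open>\<^sup>\<rho>M(\<^sup>*\<real>)\<^sup>k\<close> and \<open>\<^sup>\<rho>\<real>\<^sup>k\<close>\<close>

definition moderate_seqs :: "nat filter \<Rightarrow> (nat \<Rightarrow> real) set" where
  "moderate_seqs \<U> = {x. \<exists>c :: nat \<Rightarrow> nat. \<forall>\<^sub>F n in \<U>. \<bar>x n\<bar> \<le> real n ^ c n}"

definition moderate_nets :: "nat filter \<Rightarrow> (nat \<Rightarrow> (real^'n::finite) set) \<Rightarrow> (nat \<Rightarrow> real^'n) set" where
  "moderate_nets \<U> V = {x. (\<forall>n. x n \<in> V n) \<and> (\<forall>i. (\<lambda>n. x n $ i) \<in> moderate_seqs \<U>)}"

definition star_vec :: "nat filter \<Rightarrow> (nat \<Rightarrow> real^'n::finite) \<Rightarrow> real star ^ 'n" where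
  "star_vec \<U> x = (\<chi> i. star_cls \<U> (\<lambda>n. x n $ i))"

definition rho_proj_vec :: "nat filter \<Rightarrow> real star ^ 'n::finite \<Rightarrow> real rho ^ 'n" where
  "rho_proj_vec \<U> x = (\<chi> i. rho_proj \<U> (x $ i))"

definition star_box :: "nat filter \<Rightarrow> (nat \<Rightarrow> (real^'n::finite) set) \<Rightarrow> (real star ^ 'n) set" where
  "star_box \<U> V = star_vec \<U> ` moderate_nets \<U> V"

definition rho_box :: "nat filter \<Rightarrow> (nat \<Rightarrow> (real^'n::finite) set) \<Rightarrow> (real rho ^ 'n) set" where
  "rho_box \<U> V = (\<lambda>x. rho_proj_vec \<U> (star_vec \<U> x)) ` moderate_nets \<U> V"

definition rho_topology :: "nat filter \<Rightarrow> (real rho ^ 'n::finite) topology" where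
  "rho_topology \<U> = topology_generated_by {rho_box \<U> V | V. \<forall>n. open (V n)}"

definition rho_ext :: "nat filter \<Rightarrow> (real^'n::finite) set \<Rightarrow> (real rho ^ 'n) set" where
  "rho_ext \<U> W = rho_box \<U> (\<lambda>n. W)"

definition star_preimage :: "nat filter \<Rightarrow> (real rho ^ 'n::finite) set \<Rightarrow> (real star ^ 'n) set" where
  "star_preimage \<U> U = {x. (\<forall>i. x $ i \<in> star_M \<U>) \<and> rho_proj_vec \<U> x \<in> U}"


section \<open>Smooth functions on open subsets of \<open>\<^sup>\<rho>\<real>\<^sup>k\<close>\<close>

definition local_rep ::
  "nat filter \<Rightarrow> (real star ^ 'n::finite) set \<Rightarrow> (real star ^ 'n \<Rightarrow> 'f::real_normed_field star) \<Rightarrow>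
   real star ^ 'n \<Rightarrow> (nat \<Rightarrow> (real^'n) set) \<Rightarrow> (nat \<Rightarrow> real^'n \<Rightarrow> 'f) \<Rightarrow> bool" where
  "local_rep \<U> U' f x V g \<longleftrightarrow>
     (\<forall>n. open (V n)) \<and> x \<in> star_box \<U> V \<and> star_box \<U> V \<subseteq> U'
     \<and> (\<forall>n. smooth_on (V n) (g n))
     \<and> (\<forall>y\<in>moderate_nets \<U> V. f (star_vec \<U> y) = star_cls \<U> (\<lambda>n. g n (y n)))"

text \<open>
  The value \<open>z\<close> is unique: two local representatives of \<open>f\<close> whose partial derivatives differ
  a.e. along a net take different values a.e. along some nearby net.
\<close>

definition star_partial ::
  "nat filter \<Rightarrow> (real star ^ 'n::finite) set \<Rightarrow> 'n \<Rightarrow>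
   (real star ^ 'n \<Rightarrow> 'f::real_normed_field star) \<Rightarrow> real star ^ 'n \<Rightarrow> 'f star" where
  "star_partial \<U> U' i f = (\<lambda>x\<in>U'. THE z. \<exists>V g y. local_rep \<U> U' f x V g
     \<and> y \<in> moderate_nets \<U> V \<and> x = star_vec \<U> y \<and> z = star_cls \<U> (\<lambda>n. partial i (g n) (y n)))"

definition star_smooth ::
  "nat filter \<Rightarrow> (real star ^ 'n::finite) set \<Rightarrow>
   ('f::real_normed_field star, real star ^ 'n \<Rightarrow> 'f star, 'n) dalg" where
  "star_smooth \<U> U' = fun_dalg U' (star_ring \<U>)
     {f \<in> U' \<rightarrow>\<^sub>E carrier (star_ring \<U>). \<forall>x\<in>U'. \<exists>V g. local_rep \<U> U' f x V g}
     (star_partial \<U> U')"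

definition star_smooth_L ::
  "nat filter \<Rightarrow> (real star ^ 'n::{finite, linorder}) set \<Rightarrow> 'f::real_normed_field star set \<Rightarrow>
   (real star ^ 'n::{finite, linorder} \<Rightarrow> 'f star) set" where
  "star_smooth_L \<U> U' L = {\<phi> \<in> carrier (star_smooth \<U> U').
     \<forall>\<alpha>. \<forall>y\<in>U'. multi_pder (star_smooth \<U> U') \<alpha> \<phi> y \<in> L}"

definition rho_smooth ::
  "nat filter \<Rightarrow> (real rho ^ 'n::{finite, linorder}) set \<Rightarrow>
   ('f::real_normed_field rho, (real star ^ 'n::{finite, linorder} \<Rightarrow> 'f star) set, 'n) dalg" where
  "rho_smooth \<U> U =
     (let U' = star_preimage \<U> U
      in quot_dalg ((star_smooth \<U> U')\<lparr>carrier := star_smooth_L \<U> U' (star_M \<U>)\<rparr>)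
           (star_smooth_L \<U> U' (star_N \<U>)))"

definition rho_const :: "nat filter \<Rightarrow> 'f::real_normed_field \<Rightarrow> 'f rho" where
  "rho_const \<U> c = rho_proj \<U> (star_cls \<U> (\<lambda>n. c))"

end

theory Submission
  imports Defs
begin

text \<open>
  The exponents in the definitions of moderate and of negligible elements range over all of
  \<open>\<^sup>*\<nat>\<close>, so they may be chosen separately for each index \<open>n\<close>.  For \<open>n \<ge> 2\<close> some power of \<open>n\<close>
  exceeds \<open>\<bar>x\<^sub>n\<bar>\<close>, and if \<open>x\<^sub>n \<noteq> 0\<close> some power of \<open>1/n\<close> lies below it.  Hence every class is
  moderate and only zero is negligible (\<open>star_M_eq_carrier\<close>, \<open>star_N_eq_zero\<close>).  Consequently the
  quotients \<open>\<^sup>\<rho>\<bbbF>\<close> and \<open>\<^sup>\<rho>C\<^sup>\<infinity>(U, \<^sup>\<rho>\<bbbF>)\<close> are quotients by the zero ideal: their elements are the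
  singletons \<open>{x}\<close>, and \<open>x \<mapsto> {x}\<close> is an isomorphism (\<open>dalg_hom_quot_zero\<close>, \<open>rho_smooth_eq\<close>).

  What remains concerns functions on an ultraproduct that are locally given by a sequence of smooth
  functions on open sets \<open>V n\<close>.  Such a function determines its sequence almost everywhere: if two
  sequences differed on \<open>V n \<inter> W n\<close> for almost all \<open>n\<close>, a net of points at which they differ would
  receive two values (\<open>internal_rep_agree\<close>).  Since the \<open>V n\<close> are open, the partial derivatives
  of the sequences agree as well, so the derivations are well defined, and sums, products and
  derivatives are represented by the entrywise ones.  The axioms of a differential algebra then
  hold because they hold for smooth functions on open sets of \<open>\<real>\<^sup>k\<close>; commutation of the
  derivations is Schwarz's theorem (\<open>partial_commute\<close>).

  Evaluation at points is injective because functions are determined by their values, and the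
  embedding of \<open>C\<^sup>\<infinity>(W, \<bbbF>)\<close> sends \<open>f\<close> to the function represented everywhere by the constant
  sequence \<open>f\<close>; it is injective because constant nets recover the values of \<open>f\<close>.
\<close>

section \<open>Partial derivatives and smooth functions\<close>

lemma line_in_open:
  fixes V :: "(real^'n::finite) set"
  assumes "open V" "x \<in> V"
  shows "\<forall>\<^sub>F t in nhds (0::real). x + t *\<^sub>R axis i 1 \<in> V"
proof -
  have "open ((\<lambda>t::real. x + t *\<^sub>R axis i 1) -` V)"
    using assms(1) by (intro open_vimage continuous_intros)
  from eventually_nhds_in_open[OF this, of 0] assms(2) show ?thesis by simp
qed

lemma has_partial:
  assumes "(\<lambda>t. g (x + t *\<^sub>R axis i 1)) differentiable (at 0)"
  shows "((\<lambda>t. g (x + t *\<^sub>R axis i 1)) has_vector_derivative partial i g x) (at 0)"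
  using assms vector_derivative_works unfolding partial_def by blast

lemma partialI:
  "((\<lambda>t. g (x + t *\<^sub>R axis i 1)) has_vector_derivative D) (at 0) \<Longrightarrow> partial i g x = D"
  unfolding partial_def by (rule vector_derivative_at)

text \<open>
  Both sides depend only on the values on a short segment through \<open>x\<close>, which stays in \<open>V\<close>.
\<close>

lemma
  fixes f g :: "real^'n::finite \<Rightarrow> 'f::real_normed_vector"
  assumes "open V" "x \<in> V" "\<And>y. y \<in> V \<Longrightarrow> f y = g y"
  shows partial_cong_open: "partial i f x = partial i g x"
    and differentiable_line_cong_open:
      "(\<lambda>t. f (x + t *\<^sub>R axis i 1)) differentiable (at 0) \<longleftrightarrow>
       (\<lambda>t. g (x + t *\<^sub>R axis i 1)) differentiable (at 0)"
proof -
  have ev: "\<forall>\<^sub>F t in nhds (0::real). f (x + t *\<^sub>R axis i 1) = g (x + t *\<^sub>R axis i 1)"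
    using line_in_open[OF assms(1,2)] by eventually_elim (rule assms(3))
  show "partial i f x = partial i g x"
    unfolding partial_def using ev by (intro vector_derivative_cong_eq) auto
  have imp: "((\<lambda>t. k (x + t *\<^sub>R axis i 1)) has_derivative D) (at 0)"
    if "((\<lambda>t. h (x + t *\<^sub>R axis i 1)) has_derivative D) (at 0)"
      and "\<forall>\<^sub>F t in nhds (0::real). h (x + t *\<^sub>R axis i 1) = k (x + t *\<^sub>R axis i 1)"
    for h k :: "real^'n \<Rightarrow> 'f" and D
  proof (rule has_derivative_transform_eventually[OF that(1)])
    show "\<forall>\<^sub>F t in at 0. h (x + t *\<^sub>R axis i 1) = k (x + t *\<^sub>R axis i 1)"
      using that(2) by (rule filter_leD[OF at_within_le_nhds])
    show "h (x + 0 *\<^sub>R axis i 1) = k (x + 0 *\<^sub>R axis i 1)"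
      using that(2) by (rule eventually_nhds_x_imp_x)
  qed simp
  have ev': "\<forall>\<^sub>F t in nhds (0::real). g (x + t *\<^sub>R axis i 1) = f (x + t *\<^sub>R axis i 1)"
    using ev by eventually_elim (rule sym)
  show "(\<lambda>t. f (x + t *\<^sub>R axis i 1)) differentiable (at 0) \<longleftrightarrow>
       (\<lambda>t. g (x + t *\<^sub>R axis i 1)) differentiable (at 0)"
    unfolding differentiable_def
    using imp[OF _ ev] imp[OF _ ev'] by blast
qed

lemma cont_diff_on_cong:
  assumes "open V" "\<And>y. y \<in> V \<Longrightarrow> f y = g y"
  shows "cont_diff_on m V f \<longleftrightarrow> cont_diff_on m V g"
  using assms
proof (induction m arbitrary: f g)
  case 0
  then show ?case by (simp cong: continuous_on_cong)
next
  case (Suc m)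
  have "cont_diff_on m V (partial i f) \<longleftrightarrow> cont_diff_on m V (partial i g)" for i
    by (intro Suc.IH Suc.prems(1) partial_cong_open[of V _ f g] Suc.prems(2))
  moreover have "(\<lambda>t. f (x + t *\<^sub>R axis i 1)) differentiable (at 0) \<longleftrightarrow>
       (\<lambda>t. g (x + t *\<^sub>R axis i 1)) differentiable (at 0)" if "x \<in> V" for x i
    by (intro differentiable_line_cong_open[of V x f g] Suc.prems that)
  moreover have "continuous_on V f \<longleftrightarrow> continuous_on V g"
    using Suc.prems(2) by (intro continuous_on_cong refl)
  ultimately show ?case by simp
qed

lemma cont_diff_on_subset: "cont_diff_on m V g \<Longrightarrow> W \<subseteq> V \<Longrightarrow> cont_diff_on m W g"
  by (induction m arbitrary: g) (auto intro: continuous_on_subset)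

lemma cont_diff_on_Suc_imp: "cont_diff_on (Suc m) V g \<Longrightarrow> cont_diff_on m V g"
  by (induction m arbitrary: g) auto

lemma partial_const [simp]: "partial i (\<lambda>y. c) x = 0"
  by (rule partialI) simp

lemma cont_diff_on_const:
  fixes c :: "'f::real_normed_vector" and V :: "(real^'n::finite) set"
  shows "cont_diff_on m V (\<lambda>y. c)"
proof (induction m arbitrary: c)
  case (Suc m)
  have "partial i (\<lambda>y. c) = (\<lambda>y. 0)" for i :: 'n and c :: 'f by (rule ext) simp
  then show ?case using Suc by simp
qed simp

lemma partial_add:
  assumes "(\<lambda>t. f (x + t *\<^sub>R axis i 1)) differentiable (at 0)"
    and "(\<lambda>t. g (x + t *\<^sub>R axis i 1)) differentiable (at 0)"
  shows "partial i (\<lambda>y. f y + g y) x = partial i f x + partial i g x"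
  by (intro partialI has_vector_derivative_add has_partial assms)

lemma partial_mult:
  fixes f g :: "real^'n::finite \<Rightarrow> 'f::real_normed_field"
  assumes "(\<lambda>t. f (x + t *\<^sub>R axis i 1)) differentiable (at 0)"
    and "(\<lambda>t. g (x + t *\<^sub>R axis i 1)) differentiable (at 0)"
  shows "partial i (\<lambda>y. f y * g y) x = partial i f x * g x + f x * partial i g x"
  using has_vector_derivative_mult[OF has_partial[OF assms(1)] has_partial[OF assms(2)]]
  by (intro partialI) (simp add: add.commute)

text \<open>
  In the induction step the derivative of the sum equals the sum of the derivatives only on \<open>V\<close>, so
  the induction hypothesis is transported along equality on the open set \<open>V\<close>.
\<close>

lemma cont_diff_on_add:
  assumes "open V" "cont_diff_on m V f" "cont_diff_on m V g"
  shows "cont_diff_on m V (\<lambda>y. f y + g y)"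
  using assms
proof (induction m arbitrary: f g)
  case 0
  then show ?case by (auto intro: continuous_on_add)
next
  case (Suc m)
  have "cont_diff_on m V (\<lambda>x. partial i f x + partial i g x)" for i
    using Suc by auto
  then have "cont_diff_on m V (partial i (\<lambda>y. f y + g y))" for i
    by (rule iffD1[OF cont_diff_on_cong[OF Suc.prems(1)], rotated])
       (use Suc.prems partial_add[of f _ i g] in auto)
  with Suc.prems show ?case by (auto intro: continuous_on_add)
qed

lemma cont_diff_on_mult:
  fixes f g :: "real^'n::finite \<Rightarrow> 'f::real_normed_field"
  assumes "open V" "cont_diff_on m V f" "cont_diff_on m V g"
  shows "cont_diff_on m V (\<lambda>y. f y * g y)"
  using assms
proof (induction m arbitrary: f g)
  case 0
  then show ?case by (auto intro: continuous_on_mult)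
next
  case (Suc m)
  have "cont_diff_on m V (\<lambda>x. partial i f x * g x + f x * partial i g x)" for i
    using Suc.prems cont_diff_on_Suc_imp[of m V f] cont_diff_on_Suc_imp[of m V g]
    by (intro cont_diff_on_add Suc.IH) auto
  then have "cont_diff_on m V (partial i (\<lambda>y. f y * g y))" for i
    by (rule iffD1[OF cont_diff_on_cong[OF Suc.prems(1)], rotated])
       (use Suc.prems partial_mult[of f _ i g] in auto)
  with Suc.prems show ?case by (auto intro: continuous_on_mult differentiable_mult)
qed

lemma smooth_onD:
  assumes "smooth_on V g"
  shows "continuous_on V g"
    and "x \<in> V \<Longrightarrow> (\<lambda>t. g (x + t *\<^sub>R axis i 1)) differentiable (at 0)"
    and "smooth_on V (partial i g)"
  using assms unfolding smooth_on_def
  by (metis cont_diff_on.simps(1), metis cont_diff_on.simps(2), metis cont_diff_on.simps(2))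

lemma smooth_on_subset: "smooth_on V g \<Longrightarrow> W \<subseteq> V \<Longrightarrow> smooth_on W g"
  unfolding smooth_on_def by (blast intro: cont_diff_on_subset)

text \<open>
  The mean value inequality for \<open>f s - s D\<close>, in the form in which it bounds the error of replacing
  a varying derivative by the constant \<open>D\<close>.
\<close>

lemma mean_value_estimate:
  fixes f :: "real \<Rightarrow> 'f::real_normed_vector"
  assumes "0 \<le> t"
    and "\<And>s. 0 \<le> s \<Longrightarrow> s \<le> t \<Longrightarrow> (f has_vector_derivative f' s) (at s)"
    and "\<And>s. 0 \<le> s \<Longrightarrow> s \<le> t \<Longrightarrow> norm (f' s - D) \<le> B"
  shows "norm (f t - f 0 - t *\<^sub>R D) \<le> t * B"
proof -
  have "norm ((f t - t *\<^sub>R D) - (f 0 - 0 *\<^sub>R D)) \<le> B * norm (t - 0)"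
  proof (rule differentiable_bound[where S = "{0..t}" and f' = "\<lambda>s h. h *\<^sub>R (f' s - D)"])
    fix s assume s: "s \<in> {0..t}"
    then have "(f has_vector_derivative f' s) (at s)" using assms(2) by simp
    then have "((\<lambda>s. f s - s *\<^sub>R D) has_vector_derivative (f' s - D)) (at s)"
      by (auto simp: has_vector_derivative_def algebra_simps intro!: derivative_eq_intros)
    then show "((\<lambda>s. f s - s *\<^sub>R D) has_derivative (\<lambda>h. h *\<^sub>R (f' s - D))) (at s within {0..t})"
      unfolding has_vector_derivative_def by (rule has_derivative_at_withinI)
    show "onorm (\<lambda>h. h *\<^sub>R (f' s - D)) \<le> B"
      using assms(3)[of s] s by (intro onorm_le) (simp add: mult.commute[of B] mult_left_mono)
  qed (use assms(1) in auto)
  then show ?thesis using assms(1) by (simp add: algebra_simps)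
qed

text \<open>
  The second difference of \<open>g\<close> over a small square of side \<open>t\<close> at \<open>x\<close> is \<open>t\<^sup>2\<close> times the mixed partial
  derivative, up to an error \<open>o(t\<^sup>2)\<close>: the mean value inequality is applied first along \<open>j\<close> to
  \<open>partial i g\<close> and then along \<open>i\<close> to \<open>g (\<sqdot> + t e\<^sub>j) - g\<close>.  Working with inequalities rather than with
  intermediate points makes the argument apply to vector-valued \<open>g\<close>.
\<close>

lemma second_difference_estimate:
  fixes g :: "real^'n::finite \<Rightarrow> 'f::real_normed_vector"
  assumes "open V" "x \<in> V" "smooth_on V g" "e > 0"
  shows "\<exists>d>0. \<forall>t. 0 < t \<longrightarrow> t < d \<longrightarrow>
    norm (g (x + t *\<^sub>R axis i 1 + t *\<^sub>R axis j 1) - g (x + t *\<^sub>R axis i 1)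
          - (g (x + t *\<^sub>R axis j 1) - g x) - (t * t) *\<^sub>R partial j (partial i g) x) \<le> t * t * e"
proof -
  let ?h = "partial j (partial i g)"
  have "continuous_on V ?h" by (intro smooth_onD assms)
  then have "isCont ?h x" using assms(1,2) by (simp add: continuous_on_eq_continuous_at)
  then obtain d1 where "d1 > 0" and d1: "\<And>y. dist y x < d1 \<Longrightarrow> dist (?h y) (?h x) < e"
    using assms(4) unfolding continuous_at_eps_delta by blast
  obtain d2 where "d2 > 0" and d2: "ball x d2 \<subseteq> V"
    using assms(1,2) open_contains_ball by blast
  define d where "d = min d1 d2 / 2"
  have near: "x + s *\<^sub>R axis i 1 + r *\<^sub>R axis j 1 \<in> V"
      "norm (?h (x + s *\<^sub>R axis i 1 + r *\<^sub>R axis j 1) - ?h x) \<le> e"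
    if "0 \<le> s" "s < d" "0 \<le> r" "r < d" for s r
  proof -
    have "dist (x + s *\<^sub>R axis i 1 + r *\<^sub>R axis j 1) x
        = norm (s *\<^sub>R axis i (1::real) + r *\<^sub>R axis j (1::real) :: real^'n)"
      by (simp add: dist_norm add.assoc)
    also have "\<dots> \<le> norm (s *\<^sub>R axis i (1::real) :: real^'n) + norm (r *\<^sub>R axis j (1::real) :: real^'n)"
      by (rule norm_triangle_ineq)
    also have "\<dots> < min d1 d2"
      using that by (simp add: d_def norm_axis_1)
    finally have *: "dist (x + s *\<^sub>R axis i 1 + r *\<^sub>R axis j 1) x < min d1 d2" .
    then show "x + s *\<^sub>R axis i 1 + r *\<^sub>R axis j 1 \<in> V"
      using d2 by (auto simp: dist_commute)
    show "norm (?h (x + s *\<^sub>R axis i 1 + r *\<^sub>R axis j 1) - ?h x) \<le> e"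
      using d1[of "x + s *\<^sub>R axis i 1 + r *\<^sub>R axis j 1"] * by (simp add: dist_norm)
  qed
  have line: "((\<lambda>t. k (y + t *\<^sub>R axis l 1)) has_vector_derivative partial l k (y + s *\<^sub>R axis l 1)) (at s)"
    if "smooth_on V k" "y + s *\<^sub>R axis l 1 \<in> V"
    for k :: "real^'n \<Rightarrow> 'f" and y l s
  proof -
    have "((\<lambda>t. k ((y + s *\<^sub>R axis l 1) + t *\<^sub>R axis l 1)) has_vector_derivative
        partial l k (y + s *\<^sub>R axis l 1)) (at (s - s))"
      using has_partial[OF smooth_onD(2)[OF that]] by simp
    moreover have "((\<lambda>t. t - s) has_vector_derivative 1) (at s)"
      by (auto intro!: derivative_eq_intros)
    ultimately show ?thesis
      using vector_diff_chain_at[of "\<lambda>t. t - s" 1 s] by (fastforce simp: o_def algebra_simps)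
  qed
  have "norm (g (x + t *\<^sub>R axis i 1 + t *\<^sub>R axis j 1) - g (x + t *\<^sub>R axis i 1)
          - (g (x + t *\<^sub>R axis j 1) - g x) - (t * t) *\<^sub>R ?h x) \<le> t * t * e"
    if t: "0 < t" "t < d" for t
  proof -
    have inner: "norm (partial i g (x + s *\<^sub>R axis i 1 + t *\<^sub>R axis j 1)
        - partial i g (x + s *\<^sub>R axis i 1) - t *\<^sub>R ?h x) \<le> t * e"
      if s: "0 \<le> s" "s \<le> t" for s
    proof -
      have "norm (partial i g (x + s *\<^sub>R axis i 1 + t *\<^sub>R axis j 1)
          - partial i g (x + s *\<^sub>R axis i 1 + 0 *\<^sub>R axis j 1) - t *\<^sub>R ?h x) \<le> t * e"
      proof (rule mean_value_estimate)
        fix r assume r: "0 \<le> r" "r \<le> t"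
        show "((\<lambda>r. partial i g (x + s *\<^sub>R axis i 1 + r *\<^sub>R axis j 1)) has_vector_derivative
            ?h (x + s *\<^sub>R axis i 1 + r *\<^sub>R axis j 1)) (at r)"
          using near(1)[of s r] s r t by (intro line smooth_onD assms) auto
        show "norm (?h (x + s *\<^sub>R axis i 1 + r *\<^sub>R axis j 1) - ?h x) \<le> e"
          using near(2)[of s r] s r t by auto
      qed (use t in simp)
      then show ?thesis by simp
    qed
    have deriv: "((\<lambda>s. g (x + s *\<^sub>R axis i 1 + t *\<^sub>R axis j 1) - g (x + s *\<^sub>R axis i 1)) has_vector_derivative
        partial i g (x + s *\<^sub>R axis i 1 + t *\<^sub>R axis j 1) - partial i g (x + s *\<^sub>R axis i 1)) (at s)"
      if s: "0 \<le> s" "s \<le> t" for s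
    proof (rule has_vector_derivative_diff)
      have swap: "x + r *\<^sub>R axis i 1 + t *\<^sub>R axis j 1 = x + t *\<^sub>R axis j 1 + r *\<^sub>R axis i 1" for r
        by simp
      show "((\<lambda>s. g (x + s *\<^sub>R axis i 1 + t *\<^sub>R axis j 1)) has_vector_derivative
          partial i g (x + s *\<^sub>R axis i 1 + t *\<^sub>R axis j 1)) (at s)"
        using near(1)[of s t] s t unfolding swap by (intro line assms) auto
      show "((\<lambda>s. g (x + s *\<^sub>R axis i 1)) has_vector_derivative partial i g (x + s *\<^sub>R axis i 1)) (at s)"
        using near(1)[of s 0] s t by (intro line assms) auto
    qed
    have "norm (g (x + t *\<^sub>R axis i 1 + t *\<^sub>R axis j 1) - g (x + t *\<^sub>R axis i 1)
        - (g (x + 0 *\<^sub>R axis i 1 + t *\<^sub>R axis j 1) - g (x + 0 *\<^sub>R axis i 1)) - t *\<^sub>R (t *\<^sub>R ?h x))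
        \<le> t * (t * e)"
      by (rule mean_value_estimate[OF _ deriv inner]) (use t in auto)
    then show ?thesis by (simp add: mult.assoc)
  qed
  moreover have "d > 0" using \<open>d1 > 0\<close> \<open>d2 > 0\<close> by (simp add: d_def)
  ultimately show ?thesis by blast
qed

text \<open>
  Schwarz's theorem.  The second difference is symmetric in \<open>i\<close> and \<open>j\<close>, hence approximates
  \<open>t\<^sup>2\<close> times either mixed derivative.
\<close>

lemma partial_commute:
  fixes g :: "real^'n::finite \<Rightarrow> 'f::real_normed_vector"
  assumes "open V" "x \<in> V" "smooth_on V g"
  shows "partial i (partial j g) x = partial j (partial i g) x"
proof (rule ccontr)
  let ?D = "\<lambda>t. g (x + t *\<^sub>R axis i 1 + t *\<^sub>R axis j 1) - g (x + t *\<^sub>R axis i 1)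
      - (g (x + t *\<^sub>R axis j 1) - g x)"
  let ?a = "partial j (partial i g) x" and ?b = "partial i (partial j g) x"
  assume "?b \<noteq> ?a"
  \<comment> \<open>Two errors of size \<open>e t\<^sup>2\<close> cannot bridge a gap of \<open>3 e t\<^sup>2\<close>.\<close>
  define e where "e = norm (?a - ?b) / 3"
  have "e > 0" using \<open>?b \<noteq> ?a\<close> by (simp add: e_def)
  obtain d1 where "d1 > 0" and d1: "\<And>t. 0 < t \<Longrightarrow> t < d1 \<Longrightarrow> norm (?D t - (t * t) *\<^sub>R ?a) \<le> t * t * e"
    using second_difference_estimate[OF assms \<open>e > 0\<close>, of i j] by blast
  obtain d2 where "d2 > 0" and d2: "\<And>t. 0 < t \<Longrightarrow> t < d2 \<Longrightarrow> norm (?D t - (t * t) *\<^sub>R ?b) \<le> t * t * e"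
    using second_difference_estimate[OF assms \<open>e > 0\<close>, of j i] by (auto simp: algebra_simps)
  define t where "t = min d1 d2 / 2"
  have t: "0 < t" "t < d1" "t < d2" using \<open>d1 > 0\<close> \<open>d2 > 0\<close> by (auto simp: t_def)
  have "t * t * norm (?a - ?b) = norm ((?D t - (t * t) *\<^sub>R ?b) - (?D t - (t * t) *\<^sub>R ?a))"
    by (simp add: scaleR_diff_right[symmetric])
  also have "\<dots> \<le> t * t * e + t * t * e"
    using d1[OF t(1,2)] d2[OF t(1,3)] norm_triangle_ineq4[of "?D t - (t * t) *\<^sub>R ?b" "?D t - (t * t) *\<^sub>R ?a"]
    by linarith
  finally have "norm (?a - ?b) \<le> 2 * e" using t(1) by (simp add: mult.assoc flip: distrib_left)
  then show False using \<open>e > 0\<close> by (simp add: e_def)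
qed

lemma smooth_on_const: "smooth_on V (\<lambda>y. c)"
  unfolding smooth_on_def by (simp add: cont_diff_on_const)

lemma smooth_on_add: "open V \<Longrightarrow> smooth_on V f \<Longrightarrow> smooth_on V g \<Longrightarrow> smooth_on V (\<lambda>y. f y + g y)"
  unfolding smooth_on_def by (simp add: cont_diff_on_add)

lemma smooth_on_mult:
  fixes f g :: "real^'n::finite \<Rightarrow> 'f::real_normed_field"
  shows "open V \<Longrightarrow> smooth_on V f \<Longrightarrow> smooth_on V g \<Longrightarrow> smooth_on V (\<lambda>y. f y * g y)"
  unfolding smooth_on_def by (simp add: cont_diff_on_mult)

lemma smooth_on_cong: "open V \<Longrightarrow> (\<And>y. y \<in> V \<Longrightarrow> f y = g y) \<Longrightarrow> smooth_on V f \<longleftrightarrow> smooth_on V g"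
  unfolding smooth_on_def using cont_diff_on_cong by blast

section \<open>Algebras of functions and quotients by the zero ideal\<close>

text \<open>
  The ring and module axioms hold pointwise, so only the closure properties and the rules for the
  derivations depend on the set of functions.
\<close>

lemma fun_dalg_differential_algebra:
  fixes R (structure) and C :: "('x \<Rightarrow> 'a) set" and S :: "'x set"
    and D :: "'i \<Rightarrow> ('x \<Rightarrow> 'a) \<Rightarrow> 'x \<Rightarrow> 'a"
  defines "A \<equiv> fun_dalg S R C D"
  assumes "cring R"
    and C: "C \<subseteq> S \<rightarrow>\<^sub>E carrier R"
    and one: "\<one>\<^bsub>A\<^esub> \<in> C"
    and add: "\<And>f g. f \<in> C \<Longrightarrow> g \<in> C \<Longrightarrow> f \<oplus>\<^bsub>A\<^esub> g \<in> C"
    and mult: "\<And>f g. f \<in> C \<Longrightarrow> g \<in> C \<Longrightarrow> f \<otimes>\<^bsub>A\<^esub> g \<in> C"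
    and smult: "\<And>c f. c \<in> carrier R \<Longrightarrow> f \<in> C \<Longrightarrow> c \<odot>\<^bsub>A\<^esub> f \<in> C"
    and D_closed: "\<And>i f. f \<in> C \<Longrightarrow> D i f \<in> C"
    and D_add: "\<And>i f g. f \<in> C \<Longrightarrow> g \<in> C \<Longrightarrow> D i (f \<oplus>\<^bsub>A\<^esub> g) = D i f \<oplus>\<^bsub>A\<^esub> D i g"
    and D_smult: "\<And>i c f. c \<in> carrier R \<Longrightarrow> f \<in> C \<Longrightarrow> D i (c \<odot>\<^bsub>A\<^esub> f) = c \<odot>\<^bsub>A\<^esub> D i f"
    and D_Leibniz: "\<And>i f g. f \<in> C \<Longrightarrow> g \<in> C \<Longrightarrow>
          D i (f \<otimes>\<^bsub>A\<^esub> g) = (D i f \<otimes>\<^bsub>A\<^esub> g) \<oplus>\<^bsub>A\<^esub> (f \<otimes>\<^bsub>A\<^esub> D i g)"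
    and D_commute: "\<And>i j f. f \<in> C \<Longrightarrow> D i (D j f) = D j (D i f)"
  shows "differential_algebra R A"
proof -
  interpret R: cring R by fact
  have ops: "carrier A = C" "\<And>f g. f \<otimes>\<^bsub>A\<^esub> g = (\<lambda>x\<in>S. f x \<otimes> g x)" "\<And>f g. f \<oplus>\<^bsub>A\<^esub> g = (\<lambda>x\<in>S. f x \<oplus> g x)"
      "\<And>c f. c \<odot>\<^bsub>A\<^esub> f = (\<lambda>x\<in>S. c \<otimes> f x)" "\<one>\<^bsub>A\<^esub> = (\<lambda>x\<in>S. \<one>)" "\<zero>\<^bsub>A\<^esub> = (\<lambda>x\<in>S. \<zero>)" "pder A = D"
    by (simp_all add: A_def fun_dalg_def)
  have val: "f x \<in> carrier R" if "f \<in> C" "x \<in> S" for f x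
    using C that by auto
  have undef: "f x = undefined" if "f \<in> C" "x \<notin> S" for f x
    using C that by (auto simp: PiE_def extensional_def)
  have "\<zero>\<^bsub>A\<^esub> = \<zero> \<odot>\<^bsub>A\<^esub> \<one>\<^bsub>A\<^esub>"
    by (auto simp: ops)
  then have zero: "\<zero>\<^bsub>A\<^esub> \<in> C" using smult[OF R.zero_closed one] by simp
  have neg: "\<exists>g\<in>C. g \<oplus>\<^bsub>A\<^esub> f = \<zero>\<^bsub>A\<^esub>" if "f \<in> C" for f
  proof
    show "(\<ominus> \<one>) \<odot>\<^bsub>A\<^esub> f \<in> C" using that by (intro smult) auto
    show "(\<ominus> \<one>) \<odot>\<^bsub>A\<^esub> f \<oplus>\<^bsub>A\<^esub> f = \<zero>\<^bsub>A\<^esub>"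
      using val[OF that] by (auto simp: ops R.l_minus R.l_neg intro!: restrict_ext)
  qed
  have "cring A"
  proof (intro cringI abelian_groupI comm_monoidI)
    fix f g h assume "f \<in> carrier A" "g \<in> carrier A" "h \<in> carrier A"
    then have C: "f \<in> C" "g \<in> C" "h \<in> C" by (simp_all add: ops)
    note pointwise = ops fun_eq_iff undef val R.a_assoc R.a_comm R.a_lcomm R.m_assoc R.m_comm R.m_lcomm R.r_distr
    show "f \<oplus>\<^bsub>A\<^esub> g \<oplus>\<^bsub>A\<^esub> h = f \<oplus>\<^bsub>A\<^esub> (g \<oplus>\<^bsub>A\<^esub> h)" "f \<oplus>\<^bsub>A\<^esub> g = g \<oplus>\<^bsub>A\<^esub> f" "\<zero>\<^bsub>A\<^esub> \<oplus>\<^bsub>A\<^esub> f = f"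
      "f \<otimes>\<^bsub>A\<^esub> g \<otimes>\<^bsub>A\<^esub> h = f \<otimes>\<^bsub>A\<^esub> (g \<otimes>\<^bsub>A\<^esub> h)" "f \<otimes>\<^bsub>A\<^esub> g = g \<otimes>\<^bsub>A\<^esub> f" "\<one>\<^bsub>A\<^esub> \<otimes>\<^bsub>A\<^esub> f = f"
      "(f \<oplus>\<^bsub>A\<^esub> g) \<otimes>\<^bsub>A\<^esub> h = f \<otimes>\<^bsub>A\<^esub> h \<oplus>\<^bsub>A\<^esub> g \<otimes>\<^bsub>A\<^esub> h"
      using C by (simp_all add: pointwise)
    show "\<exists>g\<in>carrier A. g \<oplus>\<^bsub>A\<^esub> f = \<zero>\<^bsub>A\<^esub>" using neg C by (simp add: ops(1))
  qed (simp_all add: ops(1) add mult one zero)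
  then have "algebra R A"
    by (rule algebraI[OF \<open>cring R\<close>])
       (simp_all add: smult ops(1), simp_all add: ops fun_eq_iff undef val R.l_distr R.r_distr R.m_assoc)
  then show ?thesis
    unfolding differential_algebra_def differential_algebra_axioms_def ops(1,7)
    using D_closed D_add D_smult D_Leibniz D_commute by blast
qed

lemma (in ring) Quot_zero:
  shows "carrier (R Quot {\<zero>}) = (\<lambda>x. {x}) ` carrier R"
    and "\<one>\<^bsub>R Quot {\<zero>}\<^esub> = {\<one>}" and "\<zero>\<^bsub>R Quot {\<zero>}\<^esub> = {\<zero>}"
    and "x \<in> carrier R \<Longrightarrow> y \<in> carrier R \<Longrightarrow> {x} \<otimes>\<^bsub>R Quot {\<zero>}\<^esub> {y} = {x \<otimes> y}"
    and "{x} \<oplus>\<^bsub>R Quot {\<zero>}\<^esub> {y} = {x \<oplus> y}"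
    and "x \<in> carrier R \<Longrightarrow> {\<zero>} +> x = {x}"
proof -
  show coset: "{\<zero>} +> x = {x}" if "x \<in> carrier R" for x
    using that by (auto simp: a_r_coset_def')
  show "carrier (R Quot {\<zero>}) = (\<lambda>x. {x}) ` carrier R"
    by (auto simp: FactRing_def A_RCOSETS_def' coset)
  show "x \<in> carrier R \<Longrightarrow> y \<in> carrier R \<Longrightarrow> {x} \<otimes>\<^bsub>R Quot {\<zero>}\<^esub> {y} = {x \<otimes> y}"
    by (simp add: FactRing_def rcoset_mult_def coset)
qed (auto simp: FactRing_def a_r_coset_def' set_add_def')

lemma dalg_hom_quot_zero:
  fixes R (structure) and A (structure)
  assumes "differential_algebra R A"
  shows "dalg_hom R A (R Quot {\<zero>\<^bsub>R\<^esub>}) (quot_dalg A {\<zero>\<^bsub>A\<^esub>}) (\<lambda>c. {c}) (\<lambda>f. {f})"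
proof -
  interpret differential_algebra R A by fact
  let ?Q = "quot_dalg A {\<zero>\<^bsub>A\<^esub>}"
  note R_Q = R.Quot_zero
  have Q: "carrier ?Q = (\<lambda>x. {x}) ` carrier A" "\<one>\<^bsub>?Q\<^esub> = {\<one>\<^bsub>A\<^esub>}" "\<zero>\<^bsub>?Q\<^esub> = {\<zero>\<^bsub>A\<^esub>}"
    "\<And>x y. x \<in> carrier A \<Longrightarrow> y \<in> carrier A \<Longrightarrow> {x} \<otimes>\<^bsub>?Q\<^esub> {y} = {x \<otimes>\<^bsub>A\<^esub> y}"
    "\<And>x y. {x} \<oplus>\<^bsub>?Q\<^esub> {y} = {x \<oplus>\<^bsub>A\<^esub> y}"
    "\<And>c x. c \<in> carrier R \<Longrightarrow> x \<in> carrier A \<Longrightarrow> {c} \<odot>\<^bsub>?Q\<^esub> {x} = {c \<odot>\<^bsub>A\<^esub> x}"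
    "\<And>i x. x \<in> carrier A \<Longrightarrow> pder ?Q i {x} = {pder A i x}"
    by (simp_all add: quot_dalg_def Quot_zero pder_closed)
  have R_cring: "cring (R Quot {\<zero>\<^bsub>R\<^esub>})"
    by (intro ideal.quotient_is_cring R.zeroideal R.is_cring)
  have "cring ?Q"
  proof (intro cringI abelian_groupI comm_monoidI)
    fix F assume "F \<in> carrier ?Q"
    then obtain f where f: "f \<in> carrier A" "F = {f}" by (auto simp: Q)
    then have "{\<ominus>\<^bsub>A\<^esub> f} \<oplus>\<^bsub>?Q\<^esub> F = \<zero>\<^bsub>?Q\<^esub>" by (simp add: Q M.l_neg)
    then show "\<exists>G\<in>carrier ?Q. G \<oplus>\<^bsub>?Q\<^esub> F = \<zero>\<^bsub>?Q\<^esub>" using f by (auto simp: Q(1))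
  qed (auto simp: Q M.a_ac m_ac r_distr)
  then have "algebra (R Quot {\<zero>\<^bsub>R\<^esub>}) ?Q"
    by (rule algebraI[OF R_cring])
       (auto simp: Q R_Q smult_l_distr smult_r_distr smult_assoc1 smult_assoc2)
  then have "differential_algebra (R Quot {\<zero>\<^bsub>R\<^esub>}) ?Q"
    unfolding differential_algebra_def differential_algebra_axioms_def
    by (auto simp: Q R_Q pder_closed pder_add pder_smult pder_Leibniz intro: pder_commute)
  then show ?thesis
    using assms unfolding dalg_hom_def by (auto simp: Q R_Q intro!: ring_hom_memI)
qed

lemma dalg_hom_compose:
  assumes "dalg_hom R A S B \<sigma> h" and "dalg_hom S B T C \<tau> k"
  shows "dalg_hom R A T C (\<tau> \<circ> \<sigma>) (k \<circ> h)"
  using assms unfolding dalg_hom_def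
  by (auto intro: ring_hom_trans simp: ring_hom_memE(1))

lemma (in differential_algebra) pder_zero: "pder A i \<zero>\<^bsub>A\<^esub> = \<zero>\<^bsub>A\<^esub>"
  using pder_smult[of \<zero> "\<zero>\<^bsub>A\<^esub>" i] by (simp add: pder_closed)

lemma
  fixes A :: "('a, 'b, 'i::{finite, linorder}, 'm) dalg_scheme"
  assumes "differential_algebra R A"
  shows multi_pder_closed: "x \<in> carrier A \<Longrightarrow> multi_pder A \<alpha> x \<in> carrier A"
    and multi_pder_zero: "multi_pder A \<alpha> \<zero>\<^bsub>A\<^esub> = \<zero>\<^bsub>A\<^esub>"
proof -
  interpret differential_algebra R A by fact
  have pow: "(pder A i ^^ k) y \<in> carrier A" if "y \<in> carrier A" for i k y
    using that by (induction k) (auto simp: pder_closed)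
  have pow_zero: "(pder A i ^^ k) \<zero>\<^bsub>A\<^esub> = \<zero>\<^bsub>A\<^esub>" for i k
    by (induction k) (auto simp: pder_zero)
  show "multi_pder A \<alpha> x \<in> carrier A" if "x \<in> carrier A"
  proof -
    have "foldr (\<lambda>i. pder A i ^^ \<alpha> i) is x \<in> carrier A" for "is"
      using that by (induction "is") (auto simp: pow)
    then show ?thesis by (simp add: multi_pder_def)
  qed
  have "foldr (\<lambda>i. pder A i ^^ \<alpha> i) is \<zero>\<^bsub>A\<^esub> = \<zero>\<^bsub>A\<^esub>" for "is"
    by (induction "is") (auto simp: pow_zero)
  then show "multi_pder A \<alpha> \<zero>\<^bsub>A\<^esub> = \<zero>\<^bsub>A\<^esub>" by (simp add: multi_pder_def)
qed

text \<open>
  The functions whose derivatives are all negligible have negligible values themselves: this is the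
  condition for the multi-index zero.
\<close>

lemma multi_pder_none: "multi_pder A (\<lambda>i. 0) f = f"
proof -
  have "foldr (\<lambda>i. pder A i ^^ 0) is f = f" for "is" by (induction "is") auto
  then show ?thesis by (simp add: multi_pder_def)
qed

lemma carrier_quot_dalg_zero:
  assumes "differential_algebra R A"
  shows "carrier (quot_dalg A {\<zero>\<^bsub>A\<^esub>}) = (\<lambda>f. {f}) ` carrier A"
proof -
  interpret differential_algebra R A by fact
  show ?thesis by (simp add: quot_dalg_def Quot_zero)
qed

section \<open>Smooth functions on an open set form a differential algebra\<close>

lemma smooth_dalg_ops:
  "carrier (smooth_dalg W) = {f \<in> extensional W. smooth_on W f}"
  "f \<otimes>\<^bsub>smooth_dalg W\<^esub> g = (\<lambda>x\<in>W. f x * g x)"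
  "f \<oplus>\<^bsub>smooth_dalg W\<^esub> g = (\<lambda>x\<in>W. f x + g x)"
  "c \<odot>\<^bsub>smooth_dalg W\<^esub> f = (\<lambda>x\<in>W. c * f x)"
  "\<one>\<^bsub>smooth_dalg W\<^esub> = (\<lambda>x\<in>W. 1)"
  "pder (smooth_dalg W) i f = (\<lambda>x\<in>W. partial i f x)"
  by (simp_all add: smooth_dalg_def fun_dalg_def cring_class_ops_def)

lemma smooth_dalg_differential_algebra:
  fixes W :: "(real^'n::finite) set"
  assumes "open W"
  shows "differential_algebra (cring_class_ops :: 'f::real_normed_field ring) (smooth_dalg W)"
proof -
  have restr: "smooth_on W (restrict h W) \<longleftrightarrow> smooth_on W h" for h :: "real^'n \<Rightarrow> 'f"
    using assms by (intro smooth_on_cong) auto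
  have partial_restr: "partial i (restrict h W) x = partial i h x" if "x \<in> W" for h :: "real^'n \<Rightarrow> 'f" and i x
    using assms that by (intro partial_cong_open[of W]) auto
  show ?thesis
    unfolding smooth_dalg_def
  proof (rule fun_dalg_differential_algebra[OF cring_class], fold smooth_dalg_def)
    fix i j and c :: 'f and f g :: "real^'n \<Rightarrow> 'f"
    assume "f \<in> {f \<in> extensional W. smooth_on W f}" "g \<in> {f \<in> extensional W. smooth_on W f}"
    then have fg: "f \<in> extensional W" "smooth_on W f" "g \<in> extensional W" "smooth_on W g" by simp_all
    note diff = smooth_onD(2)[OF fg(2)] smooth_onD(2)[OF fg(4)]
    show "f \<oplus>\<^bsub>smooth_dalg W\<^esub> g \<in> {f \<in> extensional W. smooth_on W f}"
      "f \<otimes>\<^bsub>smooth_dalg W\<^esub> g \<in> {f \<in> extensional W. smooth_on W f}"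
      "c \<odot>\<^bsub>smooth_dalg W\<^esub> f \<in> {f \<in> extensional W. smooth_on W f}"
      "(\<lambda>x\<in>W. partial i f x) \<in> {f \<in> extensional W. smooth_on W f}"
      using assms fg by (simp_all add: smooth_dalg_ops restr smooth_on_add smooth_on_mult smooth_on_const smooth_onD(3))
    show "(\<lambda>x\<in>W. partial i (f \<oplus>\<^bsub>smooth_dalg W\<^esub> g) x)
        = (\<lambda>x\<in>W. partial i f x) \<oplus>\<^bsub>smooth_dalg W\<^esub> (\<lambda>x\<in>W. partial i g x)"
      using diff by (auto simp: smooth_dalg_ops partial_restr partial_add intro!: restrict_ext)
    show "(\<lambda>x\<in>W. partial i (f \<otimes>\<^bsub>smooth_dalg W\<^esub> g) x)
        = ((\<lambda>x\<in>W. partial i f x) \<otimes>\<^bsub>smooth_dalg W\<^esub> g) \<oplus>\<^bsub>smooth_dalg W\<^esub> (f \<otimes>\<^bsub>smooth_dalg W\<^esub> (\<lambda>x\<in>W. partial i g x))"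
      using diff by (auto simp: smooth_dalg_ops partial_restr partial_mult intro!: restrict_ext)
    show "(\<lambda>x\<in>W. partial i (c \<odot>\<^bsub>smooth_dalg W\<^esub> f) x) = c \<odot>\<^bsub>smooth_dalg W\<^esub> (\<lambda>x\<in>W. partial i f x)"
      using diff by (auto simp: smooth_dalg_ops partial_restr partial_mult intro!: restrict_ext)
    show "(\<lambda>x\<in>W. partial i (\<lambda>x\<in>W. partial j f x) x) = (\<lambda>x\<in>W. partial j (\<lambda>x\<in>W. partial i f x) x)"
      using partial_commute[OF assms _ fg(2)] by (auto simp: partial_restr intro!: restrict_ext)
  qed (auto simp: smooth_dalg_ops restr smooth_on_const cring_class_ops_def PiE_def)
qed

section \<open>The ring of classes of sequences\<close>

lemma seq_ring_cring: "cring (seq_ring :: (nat \<Rightarrow> 'f::real_normed_field) ring)"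
proof (intro cringI abelian_groupI comm_monoidI)
  fix x :: "nat \<Rightarrow> 'f"
  show "\<exists>y\<in>carrier seq_ring. y \<oplus>\<^bsub>seq_ring\<^esub> x = \<zero>\<^bsub>seq_ring\<^esub>"
    by (rule bexI[of _ "\<lambda>n. - x n"]) (auto simp: seq_ring_def)
qed (auto simp: seq_ring_def algebra_simps)

lemma null_seqs_ideal: "ideal (null_seqs \<U> :: (nat \<Rightarrow> 'f::real_normed_field) set) seq_ring"
proof -
  interpret cring "seq_ring :: (nat \<Rightarrow> 'f) ring" by (rule seq_ring_cring)
  have neg: "\<ominus>\<^bsub>seq_ring\<^esub> x = (\<lambda>n. - x n)" for x :: "nat \<Rightarrow> 'f"
    by (rule minus_equality) (auto simp: seq_ring_def)
  show ?thesis
  proof (rule idealI[OF ring_axioms])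
    show "subgroup (null_seqs \<U> :: (nat \<Rightarrow> 'f) set) (add_monoid seq_ring)"
    proof (rule group.subgroupI[OF add.group_axioms])
      fix x y :: "nat \<Rightarrow> 'f" assume x: "x \<in> null_seqs \<U>"
      then show "inv\<^bsub>add_monoid seq_ring\<^esub> x \<in> null_seqs \<U>"
        using neg[of x] by (simp add: a_inv_def null_seqs_def)
      assume "y \<in> null_seqs \<U>"
      with x show "x \<otimes>\<^bsub>add_monoid seq_ring\<^esub> y \<in> null_seqs \<U>"
        by (auto simp: null_seqs_def seq_ring_def elim: eventually_elim2)
    qed (auto simp: null_seqs_def seq_ring_def intro: exI[of _ "\<lambda>n. 0"])
  qed (auto simp: null_seqs_def seq_ring_def elim: eventually_mono)
qed

lemma star_cls_eq_Collect: "star_cls \<U> x = {y. \<forall>\<^sub>F n in \<U>. y n = x n}"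
proof (intro equalityI subsetI)
  fix y assume "y \<in> {y. \<forall>\<^sub>F n in \<U>. y n = x n}"
  then have "(\<lambda>n. y n - x n) \<in> null_seqs \<U>" by (simp add: null_seqs_def)
  moreover have "y = (\<lambda>n. y n - x n) \<oplus>\<^bsub>seq_ring\<^esub> x" by (simp add: seq_ring_def)
  ultimately show "y \<in> star_cls \<U> x" unfolding star_cls_def a_r_coset_def' by blast
qed (auto simp: star_cls_def a_r_coset_def' null_seqs_def seq_ring_def elim: eventually_mono)

lemma star_cls_eq_iff: "star_cls \<U> x = star_cls \<U> y \<longleftrightarrow> (\<forall>\<^sub>F n in \<U>. x n = y n)"
proof
  assume "star_cls \<U> x = star_cls \<U> y"
  moreover have "x \<in> star_cls \<U> x" by (simp add: star_cls_eq_Collect)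
  ultimately show "\<forall>\<^sub>F n in \<U>. x n = y n" by (simp add: star_cls_eq_Collect)
next
  assume xy: "\<forall>\<^sub>F n in \<U>. x n = y n"
  have "(\<forall>\<^sub>F n in \<U>. z n = x n) \<longleftrightarrow> (\<forall>\<^sub>F n in \<U>. z n = y n)" for z
    using xy by (auto elim: eventually_elim2)
  then show "star_cls \<U> x = star_cls \<U> y" by (simp add: star_cls_eq_Collect)
qed

lemma star_ring_cring: "cring (star_ring \<U> :: 'f::real_normed_field star ring)"
  unfolding star_ring_def by (intro ideal.quotient_is_cring null_seqs_ideal seq_ring_cring)

lemma star_cls_hom: "star_cls \<U> \<in> ring_hom seq_ring (star_ring \<U>)"
  unfolding star_ring_def star_cls_def by (rule ideal.rcos_ring_hom[OF null_seqs_ideal])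

text \<open>
  The operations of \<open>\<^sup>*\<bbbF>\<close> are entrywise; all later computations in \<open>\<^sup>*\<bbbF>\<close> go through these
  equations and \<open>star_cls_eq_iff\<close>.
\<close>

lemma
  shows carrier_star_ring: "carrier (star_ring \<U>) = range (star_cls \<U> :: (nat \<Rightarrow> 'f::real_normed_field) \<Rightarrow> _)"
    and star_cls_mult: "star_cls \<U> x \<otimes>\<^bsub>star_ring \<U>\<^esub> star_cls \<U> y = star_cls \<U> (\<lambda>n. x n * y n :: 'f)"
    and star_cls_add: "star_cls \<U> x \<oplus>\<^bsub>star_ring \<U>\<^esub> star_cls \<U> y = star_cls \<U> (\<lambda>n. x n + y n :: 'f)"
    and star_ring_one: "\<one>\<^bsub>star_ring \<U>\<^esub> = star_cls \<U> (\<lambda>n. 1 :: 'f)"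
    and star_ring_zero: "\<zero>\<^bsub>star_ring \<U>\<^esub> = star_cls \<U> (\<lambda>n. 0 :: 'f)"
proof -
  show "carrier (star_ring \<U>) = range (star_cls \<U> :: (nat \<Rightarrow> 'f) \<Rightarrow> _)"
    by (auto simp: star_ring_def star_cls_def FactRing_def A_RCOSETS_def' seq_ring_def)
  have "\<zero>\<^bsub>star_ring \<U>\<^esub> = star_cls \<U> \<zero>\<^bsub>seq_ring\<^esub>"
    by (intro ring_hom_zero[OF star_cls_hom, symmetric] cring.axioms(1) seq_ring_cring star_ring_cring)
  then show "\<zero>\<^bsub>star_ring \<U>\<^esub> = star_cls \<U> (\<lambda>n. 0 :: 'f)" by (simp add: seq_ring_def)
  show "star_cls \<U> x \<otimes>\<^bsub>star_ring \<U>\<^esub> star_cls \<U> y = star_cls \<U> (\<lambda>n. x n * y n :: 'f)"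
    "star_cls \<U> x \<oplus>\<^bsub>star_ring \<U>\<^esub> star_cls \<U> y = star_cls \<U> (\<lambda>n. x n + y n :: 'f)"
    "\<one>\<^bsub>star_ring \<U>\<^esub> = star_cls \<U> (\<lambda>n. 1 :: 'f)"
    using ring_hom_memE(2,3)[OF star_cls_hom[of \<U>], of x y] ring_hom_memE(4)[OF star_cls_hom[of \<U>, where 'a = 'f]]
    by (simp_all add: seq_ring_def)
qed

lemma star_cls_uminus: "\<ominus>\<^bsub>star_ring \<U>\<^esub> star_cls \<U> x = star_cls \<U> (\<lambda>n. - x n)"
proof -
  interpret cring "star_ring \<U> :: 'a star ring" by (rule star_ring_cring)
  show ?thesis
    by (rule minus_equality) (auto simp: star_cls_add star_ring_zero carrier_star_ring)
qed

lemma star_abs_cls: "star_abs \<U> (star_cls \<U> x) = star_cls \<U> (\<lambda>n. norm (x n))"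
proof -
  have "star_cls \<U> (\<lambda>n. norm (y n)) = star_cls \<U> (\<lambda>n. norm (x n))" if "y \<in> star_cls \<U> x" for y
    using that unfolding star_cls_eq_iff by (auto simp: star_cls_eq_Collect elim: eventually_mono)
  moreover have "x \<in> star_cls \<U> x" by (simp add: star_cls_eq_Collect)
  ultimately show ?thesis unfolding star_abs_def by blast
qed

lemma star_powr_cls: "star_powr \<U> (star_cls \<U> x) (star_cls \<U> y) = star_cls \<U> (\<lambda>n. x n powr y n)"
proof -
  have "star_cls \<U> (\<lambda>n. x' n powr y' n) = star_cls \<U> (\<lambda>n. x n powr y n)"
    if "x' \<in> star_cls \<U> x" "y' \<in> star_cls \<U> y" for x' y'
    using that unfolding star_cls_eq_iff by (auto simp: star_cls_eq_Collect elim: eventually_elim2)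
  moreover have "x \<in> star_cls \<U> x" "y \<in> star_cls \<U> y" by (simp_all add: star_cls_eq_Collect)
  ultimately show ?thesis unfolding star_powr_def by blast
qed

lemma star_le_cls: "star_le \<U> (star_cls \<U> x) (star_cls \<U> y) \<longleftrightarrow> (\<forall>\<^sub>F n in \<U>. x n \<le> y n)"
proof
  assume "star_le \<U> (star_cls \<U> x) (star_cls \<U> y)"
  then obtain a b where "\<forall>\<^sub>F n in \<U>. a n = x n" "\<forall>\<^sub>F n in \<U>. b n = y n" "\<forall>\<^sub>F n in \<U>. a n \<le> b n"
    unfolding star_le_def star_cls_eq_Collect by auto
  then show "\<forall>\<^sub>F n in \<U>. x n \<le> y n" by eventually_elim simp
next
  assume "\<forall>\<^sub>F n in \<U>. x n \<le> y n"
  moreover have "x \<in> star_cls \<U> x" "y \<in> star_cls \<U> y" by (simp_all add: star_cls_eq_Collect)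
  ultimately show "star_le \<U> (star_cls \<U> x) (star_cls \<U> y)" unfolding star_le_def by blast
qed

section \<open>Hypernatural exponents: every net is moderate\<close>

lemma exists_power_ge:
  fixes n :: nat and r :: real
  assumes "n \<ge> 2"
  shows "\<exists>c. r < real n ^ c"
  by (rule real_arch_pow) (use assms in simp)

lemma free_ultrafilter_not_bot: "free_ultrafilter \<U> \<Longrightarrow> \<U> \<noteq> bot"
  unfolding free_ultrafilter_def by (elim conjE)

lemma eventually_ge_ultrafilter:
  assumes "free_ultrafilter \<U>"
  shows "\<forall>\<^sub>F n in \<U>. k \<le> n"
proof -
  have "\<not> (\<forall>\<^sub>F n in \<U>. n \<in> {..<k})" using assms unfolding free_ultrafilter_def by blast
  then have "\<forall>\<^sub>F n in \<U>. \<not> n \<in> {..<k}" using assms unfolding free_ultrafilter_def by blast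
  then show ?thesis by eventually_elim simp
qed

lemma moderate_seqs_UNIV:
  assumes "free_ultrafilter \<U>"
  shows "moderate_seqs \<U> = UNIV"
proof -
  have "x \<in> moderate_seqs \<U>" for x
  proof -
    have "\<exists>c. \<forall>n. n \<ge> 2 \<longrightarrow> \<bar>x n\<bar> < real n ^ c n"
      using exists_power_ge by (intro choice) blast
    then obtain c where c: "\<And>n. n \<ge> 2 \<Longrightarrow> \<bar>x n\<bar> < real n ^ c n" by blast
    have "\<forall>\<^sub>F n in \<U>. \<bar>x n\<bar> \<le> real n ^ c n"
      using eventually_ge_ultrafilter[OF assms, of 2] by eventually_elim (rule less_imp_le[OF c])
    then show ?thesis unfolding moderate_seqs_def by blast
  qed
  then show ?thesis by blast
qed

lemma rho_powr_eq:
  assumes "n \<ge> (1::nat)"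
  shows "(1 / real n) powr - real c = real n ^ c" "(1 / real n) powr real c = 1 / real n ^ c"
  using assms by (simp_all add: powr_minus powr_realpow power_one_over powr_divide divide_inverse power_inverse)

text \<open>
  The exponent bounding \<open>norm (x n)\<close> is chosen for each \<open>n\<close> separately, which yields an element of
  \<open>\<^sup>*\<nat>\<close>.
\<close>

lemma star_M_eq_carrier:
  assumes "free_ultrafilter \<U>"
  shows "star_M \<U> = carrier (star_ring \<U> :: 'f::real_normed_field star ring)"
proof -
  have "star_cls \<U> x \<in> star_M \<U>" for x :: "nat \<Rightarrow> 'f"
  proof -
    have "(\<lambda>n. norm (x n)) \<in> moderate_seqs \<U>" using moderate_seqs_UNIV[OF assms] by simp
    then obtain c where c: "\<forall>\<^sub>F n in \<U>. norm (x n) \<le> real n ^ c n"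
      unfolding moderate_seqs_def by auto
    have "\<forall>\<^sub>F n in \<U>. norm (x n) \<le> (1 / real n) powr - real (c n)"
      using c eventually_ge_ultrafilter[OF assms, of 1] by eventually_elim (simp add: rho_powr_eq)
    then have "star_le \<U> (star_abs \<U> (star_cls \<U> x))
        (star_powr \<U> (star_rho \<U>) (\<ominus>\<^bsub>star_ring \<U>\<^esub> star_cls \<U> (\<lambda>n. real (c n))))"
      by (simp add: star_abs_cls star_rho_def star_powr_cls star_cls_uminus star_le_cls)
    then show ?thesis unfolding star_M_def star_nats_def by (auto simp: carrier_star_ring)
  qed
  then show ?thesis by (auto simp: star_M_def carrier_star_ring)
qed

text \<open>
  If \<open>x n \<noteq> 0\<close>, then \<open>n ^ d\<close> exceeds \<open>1 / norm (x n)\<close> for a suitable \<open>d\<close> depending on \<open>n\<close>; comparing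
  \<open>x\<close> with this single hypernatural power of \<open>\<rho>\<close> already forces \<open>x n = 0\<close> almost everywhere.
\<close>

lemma star_N_eq_zero:
  assumes "free_ultrafilter \<U>"
  shows "star_N \<U> = {\<zero>\<^bsub>star_ring \<U> :: 'f::real_normed_field star ring\<^esub>}"
proof -
  have "(\<forall>d\<in>star_nats \<U>. star_le \<U> (star_abs \<U> (star_cls \<U> x)) (star_powr \<U> (star_rho \<U>) d))
        \<longleftrightarrow> (\<forall>\<^sub>F n in \<U>. x n = 0)" for x :: "nat \<Rightarrow> 'f"
  proof
    assume small: "\<forall>d\<in>star_nats \<U>. star_le \<U> (star_abs \<U> (star_cls \<U> x)) (star_powr \<U> (star_rho \<U>) d)"
    \<comment> \<open>Where \<open>x n = 0\<close>, the convention \<open>1 / 0 = 0\<close> leaves \<open>d n\<close> unconstrained, as it should.\<close>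
    have "\<exists>d. \<forall>n. n \<ge> 2 \<longrightarrow> 1 / norm (x n) < real n ^ d n"
      using exists_power_ge by (intro choice) blast
    then obtain d where d: "\<And>n. n \<ge> 2 \<Longrightarrow> 1 / norm (x n) < real n ^ d n" by blast
    have "\<forall>\<^sub>F n in \<U>. norm (x n) \<le> (1 / real n) powr real (d n)"
      using small by (auto simp: star_nats_def star_abs_cls star_rho_def star_powr_cls star_le_cls)
    then show "\<forall>\<^sub>F n in \<U>. x n = 0"
      using eventually_ge_ultrafilter[OF assms, of 2]
    proof eventually_elim
      case (elim n)
      then have le: "norm (x n) \<le> 1 / real n ^ d n" by (simp add: rho_powr_eq)
      show "x n = 0"
      proof (rule ccontr)
        assume "x n \<noteq> 0"
        then have "1 < norm (x n) * real n ^ d n"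
          using d[OF elim(2)] by (simp add: field_simps)
        moreover have "norm (x n) * real n ^ d n \<le> 1"
          using le elim(2) by (simp add: field_simps)
        ultimately show False by simp
      qed
    qed
  next
    assume "\<forall>\<^sub>F n in \<U>. x n = 0"
    then have "\<forall>\<^sub>F n in \<U>. norm (x n) \<le> (1 / real n) powr real (d n)" for d :: "nat \<Rightarrow> nat"
      by eventually_elim simp
    then show "\<forall>d\<in>star_nats \<U>. star_le \<U> (star_abs \<U> (star_cls \<U> x)) (star_powr \<U> (star_rho \<U>) d)"
      by (auto simp: star_nats_def star_abs_cls star_rho_def star_powr_cls star_le_cls)
  qed
  then have iff: "star_cls \<U> x \<in> star_N \<U> \<longleftrightarrow> star_cls \<U> x = \<zero>\<^bsub>star_ring \<U>\<^esub>" for x :: "nat \<Rightarrow> 'f"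
    by (simp add: star_N_def carrier_star_ring star_ring_zero star_cls_eq_iff rangeI)
  show ?thesis
  proof (intro equalityI subsetI)
    fix X :: "'f star" assume X: "X \<in> star_N \<U>"
    then obtain x where "X = star_cls \<U> x" by (auto simp: star_N_def carrier_star_ring)
    then show "X \<in> {\<zero>\<^bsub>star_ring \<U>\<^esub>}" using X iff by simp
  next
    fix X :: "'f star" assume "X \<in> {\<zero>\<^bsub>star_ring \<U>\<^esub>}"
    then show "X \<in> star_N \<U>" using iff[of "\<lambda>n. 0"] by (simp add: star_ring_zero)
  qed
qed

text \<open>
  After the identification of moderate and negligible elements, \<open>\<^sup>\<rho>\<bbbF>\<close> is \<open>\<^sup>*\<bbbF>\<close> with each element
  replaced by its singleton.
\<close>

lemma
  assumes "free_ultrafilter \<U>"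
  shows rho_ring_eq: "rho_ring \<U> = star_ring \<U> Quot {\<zero>\<^bsub>star_ring \<U> :: 'f::real_normed_field star ring\<^esub>}"
    and rho_proj_eq: "x \<in> carrier (star_ring \<U> :: 'f star ring) \<Longrightarrow> rho_proj \<U> x = {x}"
proof -
  have *: "star_M_ring \<U> = (star_ring \<U> :: 'f star ring)"
    by (simp add: star_M_ring_def star_M_eq_carrier[OF assms])
  show "rho_ring \<U> = star_ring \<U> Quot {\<zero>\<^bsub>star_ring \<U> :: 'f star ring\<^esub>}"
    by (simp add: rho_ring_def * star_N_eq_zero[OF assms])
  interpret cring "star_ring \<U> :: 'f star ring" by (rule star_ring_cring)
  show "x \<in> carrier (star_ring \<U> :: 'f star ring) \<Longrightarrow> rho_proj \<U> x = {x}"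
    by (simp add: rho_proj_def * star_N_eq_zero[OF assms] a_r_coset_def')
qed

section \<open>Nets of points and internally open sets\<close>

lemma star_vec_eq_iff: "star_vec \<U> x = star_vec \<U> y \<longleftrightarrow> (\<forall>\<^sub>F n in \<U>. x n = y n)"
  by (simp add: star_vec_def vec_eq_iff star_cls_eq_iff eventually_ball_finite_distrib[of UNIV, simplified])

lemma star_vec_surj:
  assumes "\<And>i. x $ i \<in> carrier (star_ring \<U>)"
  shows "x \<in> range (star_vec \<U>)"
proof -
  have "\<exists>y. \<forall>i. x $ i = star_cls \<U> (y i)"
    using assms by (intro choice) (auto simp: carrier_star_ring)
  then obtain y where "\<And>i. x $ i = star_cls \<U> (y i)" by blast
  then have "x = star_vec \<U> (\<lambda>n. \<chi> i. y i n)" by (simp add: star_vec_def vec_eq_iff)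
  then show ?thesis by blast
qed

text \<open>
  The elements of boxes are classes of nets lying in \<open>V n\<close> for every \<open>n\<close>.  A net with this property
  only almost everywhere can be altered on the exceptional indices without changing its class,
  provided that no \<open>V n\<close> is empty.
\<close>

lemma net_adjust:
  fixes V :: "nat \<Rightarrow> (real^'n::finite) set"
  assumes "\<forall>\<^sub>F n in \<U>. z n \<in> V n" and "\<forall>n. V n \<noteq> {}"
  shows "\<exists>z'. (\<forall>n. z' n \<in> V n) \<and> star_vec \<U> z' = star_vec \<U> z"
proof -
  have "\<exists>z'. \<forall>n. z' n \<in> V n \<and> (z n \<in> V n \<longrightarrow> z' n = z n)"
    using assms(2) by (intro choice) blast
  then obtain z' where z': "\<And>n. z' n \<in> V n \<and> (z n \<in> V n \<longrightarrow> z' n = z n)" by blast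
  have "star_vec \<U> z' = star_vec \<U> z"
    unfolding star_vec_eq_iff using assms(1) by eventually_elim (simp add: z')
  then show ?thesis using z' by blast
qed

text \<open>
  The preimages in \<open>\<^sup>*\<real>\<^sup>k\<close> of open sets are internally open in this sense.  The neighbourhoods are described by
  membership almost everywhere, so that intersecting two of them needs no care at the exceptional
  indices.
\<close>

definition star_open :: "nat filter \<Rightarrow> (real star ^ 'n::finite) set \<Rightarrow> bool" where
  "star_open \<U> S \<longleftrightarrow> S \<subseteq> range (star_vec \<U>) \<and>
     (\<forall>y. star_vec \<U> y \<in> S \<longrightarrow> (\<exists>V. (\<forall>n. open (V n)) \<and> (\<forall>\<^sub>F n in \<U>. y n \<in> V n) \<and>
        (\<forall>z. (\<forall>\<^sub>F n in \<U>. z n \<in> V n) \<longrightarrow> star_vec \<U> z \<in> S)))"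

context
  fixes \<U> :: "nat filter"
  assumes free: "free_ultrafilter \<U>"
begin

lemma moderate_nets_eq: "moderate_nets \<U> V = {x. \<forall>n. x n \<in> V n}"
  by (simp add: moderate_nets_def moderate_seqs_UNIV[OF free])

lemma rho_proj_vec_eq:
  assumes "x \<in> range (star_vec \<U>)"
  shows "rho_proj_vec \<U> x = (\<chi> i. {x $ i})"
  using assms by (auto simp: rho_proj_vec_def star_vec_def rho_proj_eq[OF free] carrier_star_ring vec_eq_iff)

lemma rho_proj_vec_eq_iff:
  "rho_proj_vec \<U> (star_vec \<U> x) = rho_proj_vec \<U> (star_vec \<U> y) \<longleftrightarrow> star_vec \<U> x = star_vec \<U> y"
  by (simp add: rho_proj_vec_eq rangeI vec_eq_iff)

lemma star_preimage_eq: "star_preimage \<U> U = {x \<in> range (star_vec \<U>). rho_proj_vec \<U> x \<in> U}"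
proof -
  have "(\<forall>i. x $ i \<in> star_M \<U>) \<longleftrightarrow> x \<in> range (star_vec \<U>)" for x :: "real star ^ 'n"
    using star_vec_surj[of x \<U>] by (auto simp: star_M_eq_carrier[OF free] star_vec_def carrier_star_ring)
  then show ?thesis by (auto simp: star_preimage_def)
qed

lemma rho_box_iff: "rho_proj_vec \<U> (star_vec \<U> y) \<in> rho_box \<U> V \<longleftrightarrow>
    (\<forall>n. V n \<noteq> {}) \<and> (\<forall>\<^sub>F n in \<U>. y n \<in> V n)"
proof
  assume "rho_proj_vec \<U> (star_vec \<U> y) \<in> rho_box \<U> V"
  then obtain z where z: "\<forall>n. z n \<in> V n" "star_vec \<U> y = star_vec \<U> z"
    by (auto simp: rho_box_def moderate_nets_eq rho_proj_vec_eq_iff)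
  have "\<forall>\<^sub>F n in \<U>. y n \<in> V n"
    using z(2) unfolding star_vec_eq_iff by eventually_elim (simp add: z(1))
  then show "(\<forall>n. V n \<noteq> {}) \<and> (\<forall>\<^sub>F n in \<U>. y n \<in> V n)" using z(1) by blast
next
  assume "(\<forall>n. V n \<noteq> {}) \<and> (\<forall>\<^sub>F n in \<U>. y n \<in> V n)"
  then obtain z where "\<forall>n. z n \<in> V n" "star_vec \<U> z = star_vec \<U> y"
    using net_adjust[of y V \<U>] by blast
  then show "rho_proj_vec \<U> (star_vec \<U> y) \<in> rho_box \<U> V"
    unfolding rho_box_def moderate_nets_eq by (intro image_eqI[of _ _ z]) simp_all
qed

text \<open>
  Finite intersections of boxes are again neighbourhoods of their points because two nets in the same
  class agree almost everywhere.  This is an induction over the generation of the topology.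
\<close>

lemma openin_rho_topology:
  fixes U :: "(real rho ^ 'n::finite) set"
  assumes "openin (rho_topology \<U>) U"
  shows "star_open \<U> (star_preimage \<U> U)" and "U = rho_proj_vec \<U> ` star_preimage \<U> U"
proof -
  have gen: "generate_topology_on {rho_box \<U> V | V. \<forall>n. open (V n)} U"
    using assms by (simp add: rho_topology_def openin_topology_generated_by_iff)
  \<comment> \<open>\<open>N S y\<close>: the set \<open>S\<close> contains a box-shaped neighbourhood of the point represented by \<open>y\<close>.\<close>
  define N where "N S y \<longleftrightarrow> (\<exists>V. (\<forall>n. open (V n)) \<and> (\<forall>\<^sub>F n in \<U>. y n \<in> V n) \<and>
      (\<forall>z. (\<forall>\<^sub>F n in \<U>. z n \<in> V n) \<longrightarrow> rho_proj_vec \<U> (star_vec \<U> z) \<in> S))"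
    for S :: "(real rho ^ 'n) set" and y
  have N_mono: "N S y \<Longrightarrow> S \<subseteq> T \<Longrightarrow> N T y" for S T y
    unfolding N_def by (meson subsetD)
  have N_Int: "N (S \<inter> T) y" if "N S y" "N T y" for S T y
  proof -
    obtain V where V: "\<forall>n. open (V n)" "\<forall>\<^sub>F n in \<U>. y n \<in> V n"
        "\<forall>z. (\<forall>\<^sub>F n in \<U>. z n \<in> V n) \<longrightarrow> rho_proj_vec \<U> (star_vec \<U> z) \<in> S"
      using \<open>N S y\<close> unfolding N_def by (elim exE conjE)
    obtain W where W: "\<forall>n. open (W n)" "\<forall>\<^sub>F n in \<U>. y n \<in> W n"
        "\<forall>z. (\<forall>\<^sub>F n in \<U>. z n \<in> W n) \<longrightarrow> rho_proj_vec \<U> (star_vec \<U> z) \<in> T"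
      using \<open>N T y\<close> unfolding N_def by (elim exE conjE)
    show ?thesis
      unfolding N_def using V W
      by (intro exI[of _ "\<lambda>n. V n \<inter> W n"]) (simp add: eventually_conj_iff open_Int)
  qed
  have N_box: "N (rho_box \<U> V) y" if "\<forall>n. open (V n)" "rho_proj_vec \<U> (star_vec \<U> y) \<in> rho_box \<U> V" for V y
    unfolding N_def using that by (intro exI[of _ V]) (simp add: rho_box_iff)
  have "\<forall>y. rho_proj_vec \<U> (star_vec \<U> y) \<in> U \<longrightarrow> N U y"
    using gen
  proof induction
    case (Int a b)
    then show ?case by (auto intro: N_Int)
  next
    case (UN K)
    show ?case
    proof (intro allI impI)
      fix y :: "nat \<Rightarrow> real^'n" assume "rho_proj_vec \<U> (star_vec \<U> y) \<in> \<Union>K"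
      then obtain k where k: "k \<in> K" "rho_proj_vec \<U> (star_vec \<U> y) \<in> k" by blast
      then have "N k y" using UN.IH by simp
      then show "N (\<Union>K) y" by (rule N_mono) (use k in blast)
    qed
  next
    case (Basis s)
    then show ?case by (auto intro: N_box)
  qed simp
  then show "star_open \<U> (star_preimage \<U> U)"
    by (simp add: star_open_def star_preimage_eq N_def subset_iff)
  have "u \<in> range (\<lambda>y. rho_proj_vec \<U> (star_vec \<U> y))" if "u \<in> U" for u
    using gen that by induction (auto simp: rho_box_def)
  then show "U = rho_proj_vec \<U> ` star_preimage \<U> U"
    by (fastforce simp: star_preimage_eq)
qed

end

section \<open>Internal representatives\<close>

text \<open>
  A local representation without a base point and with all conditions on \<open>V\<close> and \<open>g\<close> imposed almost
  everywhere only.  In this form representations can be added and multiplied entrywise on the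
  intersections of their domains, even if these are empty at exceptional indices.
\<close>

definition internal_rep ::
  "nat filter \<Rightarrow> (real star ^ 'n::finite) set \<Rightarrow> (real star ^ 'n \<Rightarrow> 'f::real_normed_field star) \<Rightarrow>
   (nat \<Rightarrow> (real^'n) set) \<Rightarrow> (nat \<Rightarrow> real^'n \<Rightarrow> 'f) \<Rightarrow> bool" where
  "internal_rep \<U> S f V g \<longleftrightarrow>
     (\<forall>\<^sub>F n in \<U>. open (V n) \<and> smooth_on (V n) (g n)) \<and>
     (\<forall>z. (\<forall>\<^sub>F n in \<U>. z n \<in> V n) \<longrightarrow>
        star_vec \<U> z \<in> S \<and> f (star_vec \<U> z) = star_cls \<U> (\<lambda>n. g n (z n)))"

text \<open>
  The net \<open>z\<close> picks a point of disagreement wherever there is one, and follows \<open>y\<close> elsewhere.  As both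
  sequences represent \<open>f\<close> at \<open>z\<close>, they agree there almost everywhere, so points of disagreement
  exist only at exceptional indices.
\<close>

lemma internal_rep_agree:
  assumes "internal_rep \<U> S f V g" "internal_rep \<U> S f W h"
    and "\<forall>\<^sub>F n in \<U>. y n \<in> V n" "\<forall>\<^sub>F n in \<U>. y n \<in> W n"
  shows "\<forall>\<^sub>F n in \<U>. \<forall>w\<in>V n \<inter> W n. g n w = h n w"
proof -
  have "\<exists>z. \<forall>n. (z n \<in> V n \<inter> W n \<and> g n (z n) \<noteq> h n (z n))
      \<or> (\<forall>w\<in>V n \<inter> W n. g n w = h n w) \<and> z n = y n"
    by (intro choice) blast
  then obtain z where z: "\<And>n. (z n \<in> V n \<inter> W n \<and> g n (z n) \<noteq> h n (z n))
      \<or> (\<forall>w\<in>V n \<inter> W n. g n w = h n w) \<and> z n = y n"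
    by blast
  have "z n \<in> V n" if "y n \<in> V n" for n using z[of n] that by auto
  moreover have "z n \<in> W n" if "y n \<in> W n" for n using z[of n] that by auto
  ultimately have "\<forall>\<^sub>F n in \<U>. z n \<in> V n" "\<forall>\<^sub>F n in \<U>. z n \<in> W n"
    using assms(3,4) by (auto elim: eventually_mono)
  then have "f (star_vec \<U> z) = star_cls \<U> (\<lambda>n. g n (z n))" "f (star_vec \<U> z) = star_cls \<U> (\<lambda>n. h n (z n))"
    using assms(1,2) unfolding internal_rep_def by blast+
  then have "\<forall>\<^sub>F n in \<U>. g n (z n) = h n (z n)" by (simp flip: star_cls_eq_iff)
  then show ?thesis by eventually_elim (use z in blast)
qed

text \<open>
  Internal openness of \<open>S\<close> supplies the domains of the constant functions near \<open>y\<close>.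
\<close>

lemma internal_rep_const:
  assumes "star_open \<U> S" "star_vec \<U> y \<in> S"
    and "\<And>x. x \<in> S \<Longrightarrow> f x = star_cls \<U> c"
  shows "\<exists>V. internal_rep \<U> S f V (\<lambda>n x. c n) \<and> (\<forall>\<^sub>F n in \<U>. y n \<in> V n)"
proof -
  obtain V where "\<forall>n. open (V n)" "\<forall>\<^sub>F n in \<U>. y n \<in> V n"
      "\<forall>z. (\<forall>\<^sub>F n in \<U>. z n \<in> V n) \<longrightarrow> star_vec \<U> z \<in> S"
    using assms(1,2) unfolding star_open_def by blast
  then have "internal_rep \<U> S f V (\<lambda>n x. c n)"
    using assms(3) by (simp add: internal_rep_def smooth_on_const)
  then show ?thesis using \<open>\<forall>\<^sub>F n in \<U>. y n \<in> V n\<close> by blast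
qed

lemma internal_rep_add:
  assumes "internal_rep \<U> S f V g" "internal_rep \<U> S f' V' g'"
  shows "internal_rep \<U> S (\<lambda>x\<in>S. f x \<oplus>\<^bsub>star_ring \<U>\<^esub> f' x) (\<lambda>n. V n \<inter> V' n) (\<lambda>n x. g n x + g' n x)"
proof -
  have "\<forall>\<^sub>F n in \<U>. open (V n) \<and> smooth_on (V n) (g n)" "\<forall>\<^sub>F n in \<U>. open (V' n) \<and> smooth_on (V' n) (g' n)"
    using assms unfolding internal_rep_def by blast+
  then have "\<forall>\<^sub>F n in \<U>. open (V n \<inter> V' n) \<and> smooth_on (V n \<inter> V' n) (\<lambda>x. g n x + g' n x)"
    by eventually_elim (auto intro!: smooth_on_add intro: smooth_on_subset)
  then show ?thesis
    using assms unfolding internal_rep_def by (simp add: eventually_conj_iff star_cls_add)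
qed

lemma internal_rep_mult:
  assumes "internal_rep \<U> S f V g" "internal_rep \<U> S f' V' g'"
  shows "internal_rep \<U> S (\<lambda>x\<in>S. f x \<otimes>\<^bsub>star_ring \<U>\<^esub> f' x) (\<lambda>n. V n \<inter> V' n) (\<lambda>n x. g n x * g' n x)"
proof -
  have "\<forall>\<^sub>F n in \<U>. open (V n) \<and> smooth_on (V n) (g n)" "\<forall>\<^sub>F n in \<U>. open (V' n) \<and> smooth_on (V' n) (g' n)"
    using assms unfolding internal_rep_def by blast+
  then have "\<forall>\<^sub>F n in \<U>. open (V n \<inter> V' n) \<and> smooth_on (V n \<inter> V' n) (\<lambda>x. g n x * g' n x)"
    by eventually_elim (auto intro!: smooth_on_mult intro: smooth_on_subset)
  then show ?thesis
    using assms unfolding internal_rep_def by (simp add: eventually_conj_iff star_cls_mult)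
qed

lemma internal_rep_smult:
  assumes "internal_rep \<U> S f V g"
  shows "internal_rep \<U> S (\<lambda>x\<in>S. star_cls \<U> c \<otimes>\<^bsub>star_ring \<U>\<^esub> f x) V (\<lambda>n x. c n * g n x)"
proof -
  have "\<forall>\<^sub>F n in \<U>. open (V n) \<and> smooth_on (V n) (g n)"
    using assms unfolding internal_rep_def by blast
  then have "\<forall>\<^sub>F n in \<U>. open (V n) \<and> smooth_on (V n) (\<lambda>x. c n * g n x)"
    by eventually_elim (simp add: smooth_on_mult smooth_on_const)
  then show ?thesis
    using assms unfolding internal_rep_def by (simp add: star_cls_mult)
qed

context
  fixes \<U> :: "nat filter"
  assumes free: "free_ultrafilter \<U>"
begin

lemma internal_rep_if_local_rep:
  assumes "local_rep \<U> S f x V g"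
  shows "internal_rep \<U> S f V g" and "x = star_vec \<U> y \<Longrightarrow> \<forall>\<^sub>F n in \<U>. y n \<in> V n"
proof -
  obtain y0 where y0: "\<And>n. y0 n \<in> V n" "x = star_vec \<U> y0"
    using assms by (auto simp: local_rep_def star_box_def moderate_nets_eq[OF free])
  show "\<forall>\<^sub>F n in \<U>. y n \<in> V n" if "x = star_vec \<U> y"
    using that unfolding y0(2) star_vec_eq_iff by eventually_elim (metis y0(1))
  have "star_vec \<U> z \<in> S \<and> f (star_vec \<U> z) = star_cls \<U> (\<lambda>n. g n (z n))"
    if z: "\<forall>\<^sub>F n in \<U>. z n \<in> V n" for z
  proof -
    have "\<forall>n. V n \<noteq> {}" using y0(1) by blast
    then obtain z' where z': "\<forall>n. z' n \<in> V n" "star_vec \<U> z' = star_vec \<U> z"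
      using net_adjust[OF z] by blast
    have "star_cls \<U> (\<lambda>n. g n (z' n)) = star_cls \<U> (\<lambda>n. g n (z n))"
      using z'(2) unfolding star_cls_eq_iff star_vec_eq_iff by eventually_elim simp
    moreover have "z' \<in> moderate_nets \<U> V" using z'(1) by (simp add: moderate_nets_eq[OF free])
    then have "star_vec \<U> z' \<in> S" "f (star_vec \<U> z') = star_cls \<U> (\<lambda>n. g n (z' n))"
      using assms unfolding local_rep_def star_box_def by blast+
    ultimately show ?thesis by (simp add: z'(2))
  qed
  then show "internal_rep \<U> S f V g"
    using assms by (simp add: internal_rep_def local_rep_def)
qed

text \<open>
  At the exceptional indices the domain is replaced by the whole space and the function by zero, which
  makes all conditions hold at every index and keeps \<open>y\<close> inside all domains.
\<close>

lemma local_rep_if_internal_rep: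
  assumes "internal_rep \<U> S f V g" "\<forall>\<^sub>F n in \<U>. y n \<in> V n"
  obtains V' g' where "local_rep \<U> S f (star_vec \<U> y) V' g'" "y \<in> moderate_nets \<U> V'"
    "\<forall>\<^sub>F n in \<U>. V' n = V n \<and> g' n = g n"
proof -
  define good where "good n \<longleftrightarrow> open (V n) \<and> smooth_on (V n) (g n) \<and> y n \<in> V n" for n
  define V' where "V' n = (if good n then V n else UNIV)" for n
  define g' where "g' n = (if good n then g n else (\<lambda>x. 0))" for n
  have good: "\<forall>\<^sub>F n in \<U>. good n"
    using assms by (simp add: internal_rep_def good_def eventually_conj_iff)
  have y: "y \<in> moderate_nets \<U> V'"
    by (simp add: moderate_nets_eq[OF free] V'_def good_def)
  have val: "star_vec \<U> z \<in> S \<and> f (star_vec \<U> z) = star_cls \<U> (\<lambda>n. g' n (z n))"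
    if "z \<in> moderate_nets \<U> V'" for z
  proof -
    have zV': "z n \<in> V' n" for n using that by (simp add: moderate_nets_eq[OF free])
    have "\<forall>\<^sub>F n in \<U>. z n \<in> V n" using good by eventually_elim (metis zV' V'_def)
    moreover have "star_cls \<U> (\<lambda>n. g' n (z n)) = star_cls \<U> (\<lambda>n. g n (z n))"
      unfolding star_cls_eq_iff using good by eventually_elim (simp add: g'_def)
    ultimately show ?thesis using assms(1) by (simp add: internal_rep_def)
  qed
  have "open (V' n)" "smooth_on (V' n) (g' n)" for n
    by (simp_all add: V'_def g'_def good_def smooth_on_const)
  then have "local_rep \<U> S f (star_vec \<U> y) V' g'"
    unfolding local_rep_def star_box_def using y val by blast
  moreover have "\<forall>\<^sub>F n in \<U>. V' n = V n \<and> g' n = g n"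
    using good by eventually_elim (simp add: V'_def g'_def)
  ultimately show ?thesis using that y by blast
qed

text \<open>
  Any two representations near the point agree almost everywhere on open sets containing \<open>y n\<close>, so
  their partial derivatives at \<open>y n\<close> agree almost everywhere as well.
\<close>

lemma star_partial_eq:
  assumes "internal_rep \<U> S f V g" "\<forall>\<^sub>F n in \<U>. y n \<in> V n"
  shows "star_partial \<U> S i f (star_vec \<U> y) = star_cls \<U> (\<lambda>n. partial i (g n) (y n))"
proof -
  have "star_vec \<U> y \<in> S" using assms by (simp add: internal_rep_def)
  moreover have "(THE z. \<exists>V g y'. local_rep \<U> S f (star_vec \<U> y) V g \<and> y' \<in> moderate_nets \<U> V
      \<and> star_vec \<U> y = star_vec \<U> y' \<and> z = star_cls \<U> (\<lambda>n. partial i (g n) (y' n)))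
    = star_cls \<U> (\<lambda>n. partial i (g n) (y n))" (is "The ?P = _")
  proof (rule the_equality)
    obtain V' g' where *: "local_rep \<U> S f (star_vec \<U> y) V' g'" "y \<in> moderate_nets \<U> V'"
      "\<forall>\<^sub>F n in \<U>. V' n = V n \<and> g' n = g n"
      using assms by (rule local_rep_if_internal_rep)
    have "star_cls \<U> (\<lambda>n. partial i (g n) (y n)) = star_cls \<U> (\<lambda>n. partial i (g' n) (y n))"
      unfolding star_cls_eq_iff using *(3) by eventually_elim simp
    then show "?P (star_cls \<U> (\<lambda>n. partial i (g n) (y n)))"
      using *(1,2) by blast
  next
    fix z assume "?P z"
    then obtain W h y' where W: "local_rep \<U> S f (star_vec \<U> y) W h"
      "star_vec \<U> y = star_vec \<U> y'" "z = star_cls \<U> (\<lambda>n. partial i (h n) (y' n))"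
      by blast
    have rep: "internal_rep \<U> S f W h" and yW: "\<forall>\<^sub>F n in \<U>. y n \<in> W n"
      using internal_rep_if_local_rep[OF W(1)] by blast+
    have "\<forall>\<^sub>F n in \<U>. open (W n)" "\<forall>\<^sub>F n in \<U>. open (V n)"
      using rep assms(1) by (auto simp: internal_rep_def elim: eventually_mono)
    then have "\<forall>\<^sub>F n in \<U>. partial i (h n) (y' n) = partial i (g n) (y n)"
      using internal_rep_agree[OF assms(1) rep assms(2) yW] assms(2) yW W(2)[unfolded star_vec_eq_iff]
    proof eventually_elim
      case (elim n)
      then have "partial i (h n) (y n) = partial i (g n) (y n)"
        by (intro partial_cong_open[of "V n \<inter> W n"]) auto
      with elim show ?case by simp
    qed
    then show "z = star_cls \<U> (\<lambda>n. partial i (g n) (y n))"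
      by (simp add: W(3) star_cls_eq_iff)
  qed
  ultimately show ?thesis by (simp add: star_partial_def)
qed

lemma internal_rep_star_partial:
  assumes "internal_rep \<U> S f V g"
  shows "internal_rep \<U> S (star_partial \<U> S i f) V (\<lambda>n. partial i (g n))"
  unfolding internal_rep_def
proof (intro conjI allI impI)
  have "\<forall>\<^sub>F n in \<U>. open (V n) \<and> smooth_on (V n) (g n)" using assms by (simp add: internal_rep_def)
  then show "\<forall>\<^sub>F n in \<U>. open (V n) \<and> smooth_on (V n) (partial i (g n))"
    by eventually_elim (simp add: smooth_onD(3))
  fix z assume z: "\<forall>\<^sub>F n in \<U>. z n \<in> V n"
  then show "star_vec \<U> z \<in> S" using assms by (simp add: internal_rep_def)
  show "star_partial \<U> S i f (star_vec \<U> z) = star_cls \<U> (\<lambda>n. partial i (g n) (z n))"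
    by (rule star_partial_eq[OF assms z])
qed

end

section \<open>The differential algebra of internally smooth functions\<close>

lemma star_smooth_ops:
  "f \<otimes>\<^bsub>star_smooth \<U> S\<^esub> g = (\<lambda>x\<in>S. f x \<otimes>\<^bsub>star_ring \<U>\<^esub> g x)"
  "f \<oplus>\<^bsub>star_smooth \<U> S\<^esub> g = (\<lambda>x\<in>S. f x \<oplus>\<^bsub>star_ring \<U>\<^esub> g x)"
  "c \<odot>\<^bsub>star_smooth \<U> S\<^esub> f = (\<lambda>x\<in>S. c \<otimes>\<^bsub>star_ring \<U>\<^esub> f x)"
  "\<one>\<^bsub>star_smooth \<U> S\<^esub> = (\<lambda>x\<in>S. \<one>\<^bsub>star_ring \<U>\<^esub>)"
  "\<zero>\<^bsub>star_smooth \<U> S\<^esub> = (\<lambda>x\<in>S. \<zero>\<^bsub>star_ring \<U>\<^esub>)"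
  "pder (star_smooth \<U> S) = star_partial \<U> S"
  by (simp_all add: star_smooth_def fun_dalg_def)

text \<open>
  The points of an internally open set are classes of nets; equality of functions is checked net by
  net.
\<close>

lemma extensional_eqI_star_vec:
  assumes "S \<subseteq> range (star_vec \<U>)" "f \<in> extensional S" "h \<in> extensional S"
    and "\<And>y. star_vec \<U> y \<in> S \<Longrightarrow> f (star_vec \<U> y) = h (star_vec \<U> y)"
  shows "f = h"
  by (rule extensionalityI[OF assms(2,3)]) (use assms(1,4) in blast)

context
  fixes \<U> :: "nat filter"
  assumes free: "free_ultrafilter \<U>"
begin

lemma carrier_star_smooth_iff:
  assumes "S \<subseteq> range (star_vec \<U>)"
  shows "f \<in> carrier (star_smooth \<U> S) \<longleftrightarrow> f \<in> extensional S \<and>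
    (\<forall>y. star_vec \<U> y \<in> S \<longrightarrow> (\<exists>V g. internal_rep \<U> S f V g \<and> (\<forall>\<^sub>F n in \<U>. y n \<in> V n)))"
    (is "_ \<longleftrightarrow> ?R")
proof
  assume "f \<in> carrier (star_smooth \<U> S)"
  then have ext: "f \<in> extensional S" and loc: "\<And>x. x \<in> S \<Longrightarrow> \<exists>V g. local_rep \<U> S f x V g"
    by (simp_all add: star_smooth_def fun_dalg_def PiE_def)
  have "\<exists>V g. internal_rep \<U> S f V g \<and> (\<forall>\<^sub>F n in \<U>. y n \<in> V n)" if "star_vec \<U> y \<in> S" for y
    using loc[OF that] internal_rep_if_local_rep[OF free] by blast
  with ext show ?R by blast
next
  assume R: ?R
  have "f x \<in> carrier (star_ring \<U>) \<and> (\<exists>V g. local_rep \<U> S f x V g)" if x: "x \<in> S" for x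
  proof -
    obtain y where y: "x = star_vec \<U> y" using assms x by blast
    obtain V g where rep: "internal_rep \<U> S f V g" "\<forall>\<^sub>F n in \<U>. y n \<in> V n"
      using R x y by blast
    obtain V' g' where "local_rep \<U> S f (star_vec \<U> y) V' g'"
      using local_rep_if_internal_rep[OF free rep] by blast
    moreover have "f x \<in> carrier (star_ring \<U>)"
      using rep by (simp add: internal_rep_def y carrier_star_ring rangeI)
    ultimately show ?thesis using y by blast
  qed
  then show "f \<in> carrier (star_smooth \<U> S)"
    using R by (simp add: star_smooth_def fun_dalg_def PiE_def)
qed

text \<open>
  Every point has a common internal representation of the functions involved, and each rule for the
  derivations follows from the corresponding rule for partial derivatives at the points \<open>y n\<close>.
\<close>

lemma star_smooth_differential_algebra:
  fixes S :: "(real star ^ 'n::finite) set"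
  assumes S: "star_open \<U> S"
  shows "differential_algebra (star_ring \<U> :: 'f::real_normed_field star ring) (star_smooth \<U> S)"
proof -
  let ?A = "star_smooth \<U> S :: ('f star, real star ^ 'n \<Rightarrow> 'f star, 'n) dalg"
  have sub: "S \<subseteq> range (star_vec \<U>)" using S by (simp add: star_open_def)
  note carrier_iff = carrier_star_smooth_iff[OF sub]
  note eqI = extensional_eqI_star_vec[OF sub]
  have ext: "f \<in> extensional S" if "f \<in> carrier ?A" for f
    using that by (simp add: carrier_iff)
  have rep: "\<exists>V g. internal_rep \<U> S f V g \<and> (\<forall>\<^sub>F n in \<U>. y n \<in> V n)"
    if "f \<in> carrier ?A" "star_vec \<U> y \<in> S" for f y
    using that by (simp add: carrier_iff)
  have D_ext: "star_partial \<U> S i f \<in> extensional S" for i and f :: "real star ^ 'n \<Rightarrow> 'f star"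
    by (simp add: star_partial_def)
  have carrier: "carrier ?A = {f \<in> S \<rightarrow>\<^sub>E carrier (star_ring \<U>). \<forall>x\<in>S. \<exists>V g. local_rep \<U> S f x V g}"
    by (simp add: star_smooth_def fun_dalg_def)
  have "differential_algebra (star_ring \<U>)
      (fun_dalg S (star_ring \<U> :: 'f star ring) (carrier ?A) (star_partial \<U> S))"
  proof (rule fun_dalg_differential_algebra[OF star_ring_cring],
      unfold carrier, fold star_smooth_def, fold carrier)
    show "carrier ?A \<subseteq> S \<rightarrow>\<^sub>E carrier (star_ring \<U>)"
      by (auto simp: star_smooth_def fun_dalg_def)
    show "\<one>\<^bsub>?A\<^esub> \<in> carrier ?A"
      unfolding carrier_iff
    proof (intro conjI allI impI)
      fix y assume "star_vec \<U> y \<in> S"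
      then show "\<exists>V g. internal_rep \<U> S \<one>\<^bsub>?A\<^esub> V g \<and> (\<forall>\<^sub>F n in \<U>. y n \<in> V n)"
        using internal_rep_const[OF S, of y "\<one>\<^bsub>?A\<^esub>" "\<lambda>n. 1"]
        by (fastforce simp: star_smooth_ops star_ring_one)
    qed (simp add: star_smooth_ops)
  next
    fix f g assume fg: "f \<in> carrier ?A" "g \<in> carrier ?A"
    \<comment> \<open>On the common domain of two representatives, sum and product are represented entrywise, so the rules for partial derivatives apply at almost every \<open>y n\<close>.\<close>
    {
      fix y assume "star_vec \<U> y \<in> S"
      then obtain V h V' h' where *: "internal_rep \<U> S f V h" "\<forall>\<^sub>F n in \<U>. y n \<in> V n"
          "internal_rep \<U> S g V' h'" "\<forall>\<^sub>F n in \<U>. y n \<in> V' n"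
        using rep[OF fg(1)] rep[OF fg(2)] by blast
      let ?V = "\<lambda>n. V n \<inter> V' n"
      have y: "\<forall>\<^sub>F n in \<U>. y n \<in> ?V n" using *(2,4) by (simp add: eventually_conj_iff)
      have add: "internal_rep \<U> S (f \<oplus>\<^bsub>?A\<^esub> g) ?V (\<lambda>n x. h n x + h' n x)"
        and mult: "internal_rep \<U> S (f \<otimes>\<^bsub>?A\<^esub> g) ?V (\<lambda>n x. h n x * h' n x)"
        using internal_rep_add[OF *(1,3)] internal_rep_mult[OF *(1,3)] by (simp_all add: star_smooth_ops)
      have diff: "\<forall>\<^sub>F n in \<U>. \<forall>i. (\<lambda>t. h n (y n + t *\<^sub>R axis i 1)) differentiable (at 0) \<and>
          (\<lambda>t. h' n (y n + t *\<^sub>R axis i 1)) differentiable (at 0)"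
      proof -
        have "\<forall>\<^sub>F n in \<U>. smooth_on (V n) (h n)" "\<forall>\<^sub>F n in \<U>. smooth_on (V' n) (h' n)"
          using *(1,3) by (simp_all add: internal_rep_def eventually_conj_iff)
        then show ?thesis using *(2,4) by eventually_elim (simp add: smooth_onD(2))
      qed
      have val: "f (star_vec \<U> y) = star_cls \<U> (\<lambda>n. h n (y n))" "g (star_vec \<U> y) = star_cls \<U> (\<lambda>n. h' n (y n))"
        using * by (simp_all add: internal_rep_def)
      have "star_cls \<U> (\<lambda>n. partial i (\<lambda>x. h n x + h' n x) (y n))
          = star_cls \<U> (\<lambda>n. partial i (h n) (y n) + partial i (h' n) (y n))" for i
        unfolding star_cls_eq_iff using diff by eventually_elim (simp add: partial_add)
      then have D_add: "star_partial \<U> S i (f \<oplus>\<^bsub>?A\<^esub> g) (star_vec \<U> y) =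
          (star_partial \<U> S i f \<oplus>\<^bsub>?A\<^esub> star_partial \<U> S i g) (star_vec \<U> y)" for i
        using \<open>star_vec \<U> y \<in> S\<close> star_partial_eq[OF free add y] star_partial_eq[OF free *(1,2)]
          star_partial_eq[OF free *(3,4)] by (simp add: star_smooth_ops star_cls_add)
      have "star_cls \<U> (\<lambda>n. partial i (\<lambda>x. h n x * h' n x) (y n))
          = star_cls \<U> (\<lambda>n. partial i (h n) (y n) * h' n (y n) + h n (y n) * partial i (h' n) (y n))" for i
        unfolding star_cls_eq_iff using diff by eventually_elim (simp add: partial_mult)
      then have D_mult: "star_partial \<U> S i (f \<otimes>\<^bsub>?A\<^esub> g) (star_vec \<U> y) =
          ((star_partial \<U> S i f \<otimes>\<^bsub>?A\<^esub> g) \<oplus>\<^bsub>?A\<^esub> (f \<otimes>\<^bsub>?A\<^esub> star_partial \<U> S i g)) (star_vec \<U> y)" for i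
        using \<open>star_vec \<U> y \<in> S\<close> star_partial_eq[OF free mult y] star_partial_eq[OF free *(1,2)]
          star_partial_eq[OF free *(3,4)] by (simp add: star_smooth_ops star_cls_add star_cls_mult val)
      have "\<exists>V k. internal_rep \<U> S (f \<oplus>\<^bsub>?A\<^esub> g) V k \<and> (\<forall>\<^sub>F n in \<U>. y n \<in> V n)"
        "\<exists>V k. internal_rep \<U> S (f \<otimes>\<^bsub>?A\<^esub> g) V k \<and> (\<forall>\<^sub>F n in \<U>. y n \<in> V n)"
        using add mult y by blast+
      note this D_add D_mult
    }
    note pointwise = this
    show "f \<oplus>\<^bsub>?A\<^esub> g \<in> carrier ?A" "f \<otimes>\<^bsub>?A\<^esub> g \<in> carrier ?A"
      unfolding carrier_iff using pointwise(1,2) by (simp_all add: star_smooth_ops(1,2))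
    fix i
    show "star_partial \<U> S i (f \<oplus>\<^bsub>?A\<^esub> g) = star_partial \<U> S i f \<oplus>\<^bsub>?A\<^esub> star_partial \<U> S i g"
      by (rule eqI[OF D_ext _ pointwise(3)]) (simp only: star_smooth_ops restrict_extensional)
    show "star_partial \<U> S i (f \<otimes>\<^bsub>?A\<^esub> g) =
        (star_partial \<U> S i f \<otimes>\<^bsub>?A\<^esub> g) \<oplus>\<^bsub>?A\<^esub> (f \<otimes>\<^bsub>?A\<^esub> star_partial \<U> S i g)"
      by (rule eqI[OF D_ext _ pointwise(4)]) (simp only: star_smooth_ops restrict_extensional)
  next
    fix f and c :: "'f star" and i
    assume f: "f \<in> carrier ?A" and "c \<in> carrier (star_ring \<U>)"
    then obtain c' where c: "c = star_cls \<U> c'" by (auto simp: carrier_star_ring)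
    have smult: "internal_rep \<U> S (c \<odot>\<^bsub>?A\<^esub> f) V (\<lambda>n x. c' n * h n x)" if "internal_rep \<U> S f V h" for V h
      using internal_rep_smult[OF that] by (simp add: star_smooth_ops c)
    show "c \<odot>\<^bsub>?A\<^esub> f \<in> carrier ?A"
      unfolding carrier_iff using rep[OF f] smult by (simp add: star_smooth_ops(3)) blast
    show "star_partial \<U> S i (c \<odot>\<^bsub>?A\<^esub> f) = c \<odot>\<^bsub>?A\<^esub> star_partial \<U> S i f"
    proof (rule eqI[OF D_ext])
      fix y assume y: "star_vec \<U> y \<in> S"
      then obtain V h where *: "internal_rep \<U> S f V h" "\<forall>\<^sub>F n in \<U>. y n \<in> V n"
        using rep[OF f] by blast
      have "\<forall>\<^sub>F n in \<U>. smooth_on (V n) (h n)"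
        using *(1) by (simp add: internal_rep_def eventually_conj_iff)
      then have "\<forall>\<^sub>F n in \<U>. partial i (\<lambda>x. c' n * h n x) (y n) = c' n * partial i (h n) (y n)"
        using *(2) by eventually_elim (simp add: smooth_onD(2) partial_mult)
      then have "star_cls \<U> (\<lambda>n. partial i (\<lambda>x. c' n * h n x) (y n)) = star_cls \<U> (\<lambda>n. c' n * partial i (h n) (y n))"
        unfolding star_cls_eq_iff .
      then show "star_partial \<U> S i (c \<odot>\<^bsub>?A\<^esub> f) (star_vec \<U> y) = (c \<odot>\<^bsub>?A\<^esub> star_partial \<U> S i f) (star_vec \<U> y)"
        using y star_partial_eq[OF free smult[OF *(1)] *(2)] star_partial_eq[OF free *]
        by (simp add: star_smooth_ops star_cls_mult c)
    qed (simp add: star_smooth_ops)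
  next
    fix i f assume f: "f \<in> carrier ?A"
    show "star_partial \<U> S i f \<in> carrier ?A"
      unfolding carrier_iff using D_ext rep[OF f] internal_rep_star_partial[OF free] by blast
  next
    fix i j f assume f: "f \<in> carrier ?A"
    show "star_partial \<U> S i (star_partial \<U> S j f) = star_partial \<U> S j (star_partial \<U> S i f)"
    proof (rule eqI[OF D_ext D_ext])
      fix y assume "star_vec \<U> y \<in> S"
      then obtain V h where *: "internal_rep \<U> S f V h" "\<forall>\<^sub>F n in \<U>. y n \<in> V n"
        using rep[OF f] by blast
      have "\<forall>\<^sub>F n in \<U>. open (V n) \<and> smooth_on (V n) (h n)"
        using *(1) by (simp add: internal_rep_def)
      then have "\<forall>\<^sub>F n in \<U>. partial i (partial j (h n)) (y n) = partial j (partial i (h n)) (y n)"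
        using *(2) by eventually_elim (rule partial_commute, blast+)
      then show "star_partial \<U> S i (star_partial \<U> S j f) (star_vec \<U> y)
          = star_partial \<U> S j (star_partial \<U> S i f) (star_vec \<U> y)"
        using star_partial_eq[OF free internal_rep_star_partial[OF free *(1)] *(2)]
        by (simp add: star_cls_eq_iff)
    qed
  qed
  then show ?thesis by (simp add: star_smooth_def fun_dalg_def)
qed

end

section \<open>Evaluation and the embedding of smooth functions\<close>

text \<open>
  All derivatives of an internally smooth function have moderate values, and having negligible values
  means being zero.
\<close>

lemma rho_smooth_eq:
  fixes U :: "(real rho ^ 'n::{finite, linorder}) set"
  assumes free: "free_ultrafilter \<U>" and S: "star_open \<U> (star_preimage \<U> U)"
  defines "A \<equiv> star_smooth \<U> (star_preimage \<U> U) ::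
      ('f::real_normed_field star, real star ^ 'n::{finite, linorder} \<Rightarrow> 'f star, 'n) dalg"
  shows "rho_smooth \<U> U = quot_dalg A {\<zero>\<^bsub>A\<^esub>}"
proof -
  let ?S = "star_preimage \<U> U"
  have dalg: "differential_algebra (star_ring \<U>) A"
    unfolding A_def by (rule star_smooth_differential_algebra[OF free S])
  interpret A: differential_algebra "star_ring \<U>" A by (rule dalg)
  have ext: "f \<in> ?S \<rightarrow>\<^sub>E carrier (star_ring \<U>)" if "f \<in> carrier A" for f
    using that by (simp add: A_def star_smooth_def fun_dalg_def)
  have "star_smooth_L \<U> ?S (star_M \<U>) = carrier A"
    using multi_pder_closed[OF dalg] ext
    by (auto simp: star_smooth_L_def star_M_eq_carrier[OF free] simp flip: A_def)
  moreover have "star_smooth_L \<U> ?S (star_N \<U>) = {\<zero>\<^bsub>A\<^esub>}"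
  proof (intro equalityI subsetI)
    fix f :: "real star ^ 'n::{finite, linorder} \<Rightarrow> 'f star" assume "f \<in> star_smooth_L \<U> ?S (star_N \<U>)"
    then have f: "f \<in> carrier A" and null: "\<And>\<alpha> y. y \<in> ?S \<Longrightarrow> multi_pder A \<alpha> f y = \<zero>\<^bsub>star_ring \<U>\<^esub>"
      by (simp_all add: star_smooth_L_def star_N_eq_zero[OF free] A_def)
    have "f y = \<zero>\<^bsub>star_ring \<U>\<^esub>" if "y \<in> ?S" for y
      using null[OF that, of "\<lambda>i. 0"] by (simp add: multi_pder_none)
    then have "f = \<zero>\<^bsub>A\<^esub>"
      using ext[OF f] by (auto simp: A_def star_smooth_ops PiE_def intro!: extensionalityI[of _ ?S])
    then show "f \<in> {\<zero>\<^bsub>A\<^esub>}" by simp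
  next
    fix f :: "real star ^ 'n::{finite, linorder} \<Rightarrow> 'f star" assume "f \<in> {\<zero>\<^bsub>A\<^esub>}"
    then show "f \<in> star_smooth_L \<U> ?S (star_N \<U>)"
      using multi_pder_zero[OF dalg] A.M.zero_closed
      by (simp add: star_smooth_L_def star_N_eq_zero[OF free] star_smooth_ops A_def)
  qed
  moreover have "A\<lparr>carrier := carrier A\<rparr> = A" by simp
  ultimately show ?thesis
    by (simp add: rho_smooth_def Let_def flip: A_def)
qed

text \<open>
  An element of the algebra is a singleton \<open>{\<phi>}\<close>, and a point of \<open>U\<close> is a vector of singletons; the
  evaluation takes the unique elements of both.
\<close>

lemma rho_smooth_evaluation:
  fixes U :: "(real rho ^ 'n::{finite, linorder}) set"
    and A :: "('f::real_normed_field rho, (real star ^ 'n::{finite, linorder} \<Rightarrow> 'f star) set, 'n) dalg"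
  assumes free: "free_ultrafilter \<U>" and "openin (rho_topology \<U>) U" and A: "A = rho_smooth \<U> U"
  shows "\<exists>\<iota>. \<iota> \<in> carrier A \<rightarrow> (U \<rightarrow>\<^sub>E carrier (rho_ring \<U> :: 'f rho ring))
        \<and> inj_on \<iota> (carrier A)
        \<and> (\<forall>\<Phi>\<in>carrier A. \<forall>\<phi>\<in>\<Phi>. \<forall>x\<in>star_preimage \<U> U.
             \<iota> \<Phi> (rho_proj_vec \<U> x) = rho_proj \<U> (\<phi> x))"
proof -
  let ?S = "star_preimage \<U> U" and ?R = "star_ring \<U> :: 'f star ring"
  note S = openin_rho_topology[OF free assms(2)]
  have carrier: "carrier A = (\<lambda>f. {f}) ` carrier (star_smooth \<U> ?S)"
    unfolding A rho_smooth_eq[OF free S(1)]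
    by (rule carrier_quot_dalg_zero[OF star_smooth_differential_algebra[OF free S(1)]])
  interpret R: cring ?R by (rule star_ring_cring)
  define \<iota> where "\<iota> \<Phi> = (\<lambda>u\<in>U. rho_proj \<U> (the_elem \<Phi> (\<chi> i. the_elem (u $ i))))"
    for \<Phi> :: "(real star ^ 'n::{finite, linorder} \<Rightarrow> 'f star) set"
  have S_range: "?S \<subseteq> range (star_vec \<U>)" using S(1) by (simp add: star_open_def)
  have eval: "\<iota> {\<phi>} (rho_proj_vec \<U> x) = rho_proj \<U> (\<phi> x)" if "x \<in> ?S"
    for \<phi> :: "real star ^ 'n::{finite, linorder} \<Rightarrow> 'f star" and x
  proof -
    have "rho_proj_vec \<U> x \<in> U" using S(2) that by blast
    moreover have "rho_proj_vec \<U> x = (\<chi> i. {x $ i})" using S_range that rho_proj_vec_eq[OF free] by blast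
    ultimately show ?thesis by (simp add: \<iota>_def)
  qed
  have val: "\<phi> x \<in> carrier ?R" if "\<phi> \<in> carrier (star_smooth \<U> ?S)" "x \<in> ?S" for \<phi> :: "real star ^ 'n::{finite, linorder} \<Rightarrow> 'f star" and x
    using that by (auto simp: star_smooth_def fun_dalg_def)
  have ext: "\<phi> \<in> extensional ?S" if "\<phi> \<in> carrier (star_smooth \<U> ?S)" for \<phi> :: "real star ^ 'n::{finite, linorder} \<Rightarrow> 'f star"
    using that by (simp add: star_smooth_def fun_dalg_def PiE_def)
  have "\<iota> \<in> carrier A \<rightarrow> (U \<rightarrow>\<^sub>E carrier (rho_ring \<U> :: 'f rho ring))"
  proof (intro funcsetI PiE_I)
    fix \<Phi> :: "(real star ^ 'n::{finite, linorder} \<Rightarrow> 'f star) set" and u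
    assume "\<Phi> \<in> carrier A" "u \<in> U"
    then obtain \<phi> where \<phi>: "\<phi> \<in> carrier (star_smooth \<U> ?S)" "\<Phi> = {\<phi>}" by (auto simp: carrier)
    have "u \<in> rho_proj_vec \<U> ` ?S" using \<open>u \<in> U\<close> S(2) by simp
    then obtain x where x: "x \<in> ?S" "u = rho_proj_vec \<U> x" by blast
    show "\<iota> \<Phi> u \<in> carrier (rho_ring \<U>)"
      using val[OF \<phi>(1) x(1)] by (simp add: \<phi>(2) x eval rho_proj_eq[OF free] rho_ring_eq[OF free] R.Quot_zero(1))
  qed (simp add: \<iota>_def)
  moreover have "inj_on \<iota> (carrier A)"
  proof (rule inj_onI)
    fix \<Phi> \<Psi> :: "(real star ^ 'n::{finite, linorder} \<Rightarrow> 'f star) set"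
    assume "\<Phi> \<in> carrier A" "\<Psi> \<in> carrier A" and eq: "\<iota> \<Phi> = \<iota> \<Psi>"
    then obtain \<phi> \<psi> where \<phi>: "\<phi> \<in> carrier (star_smooth \<U> ?S)" "\<Phi> = {\<phi>}"
      and \<psi>: "\<psi> \<in> carrier (star_smooth \<U> ?S)" "\<Psi> = {\<psi>}" by (auto simp: carrier)
    have "\<phi> = \<psi>"
    proof (rule extensionalityI[OF ext[OF \<phi>(1)] ext[OF \<psi>(1)]])
      fix x assume x: "x \<in> ?S"
      then have "rho_proj \<U> (\<phi> x) = rho_proj \<U> (\<psi> x)"
        using eq eval[OF x, of \<phi>] eval[OF x, of \<psi>] by (simp add: \<phi>(2) \<psi>(2))
      then show "\<phi> x = \<psi> x"
        using val[OF \<phi>(1) x] val[OF \<psi>(1) x] by (simp add: rho_proj_eq[OF free])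
    qed
    then show "\<Phi> = \<Psi>" by (simp add: \<phi>(2) \<psi>(2))
  qed
  moreover have "\<forall>\<Phi>\<in>carrier A. \<forall>\<phi>\<in>\<Phi>. \<forall>x\<in>?S. \<iota> \<Phi> (rho_proj_vec \<U> x) = rho_proj \<U> (\<phi> x)"
    by (auto simp: carrier eval)
  ultimately show ?thesis by (intro exI[of _ \<iota>] conjI)
qed

text \<open>
  The natural extension of \<open>f\<close>; the union is over equal classes.
\<close>

definition star_ext :: "nat filter \<Rightarrow> (real star ^ 'n::finite) set \<Rightarrow> (real^'n \<Rightarrow> 'f::real_normed_field) \<Rightarrow>
    real star ^ 'n \<Rightarrow> 'f star" where
  "star_ext \<U> S f = (\<lambda>x\<in>S. \<Union>y\<in>{y. star_vec \<U> y = x}. star_cls \<U> (\<lambda>n. f (y n)))"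

lemma star_ext_star_vec:
  assumes "star_vec \<U> y \<in> S"
  shows "star_ext \<U> S f (star_vec \<U> y) = star_cls \<U> (\<lambda>n. f (y n))"
proof -
  have "star_cls \<U> (\<lambda>n. f (z n)) = star_cls \<U> (\<lambda>n. f (y n))" if "star_vec \<U> z = star_vec \<U> y" for z
    using that unfolding star_vec_eq_iff star_cls_eq_iff by eventually_elim simp
  then have "(\<Union>z\<in>{z. star_vec \<U> z = star_vec \<U> y}. star_cls \<U> (\<lambda>n. f (z n))) = star_cls \<U> (\<lambda>n. f (y n))"
    by (rule SUP_eq_const[rotated]) auto
  then show ?thesis using assms by (simp add: star_ext_def)
qed

text \<open>
  The extension of \<open>f\<close> has the constant sequence \<open>f\<close> as a representative on the constant sequence
  \<open>W\<close>, so it commutes with all operations, including the derivations.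
\<close>

lemma star_ext_dalg_hom:
  fixes W :: "(real^'n::finite) set"
  assumes free: "free_ultrafilter \<U>" and W: "open W" and S: "star_open \<U> S"
    and S_iff: "\<And>y. star_vec \<U> y \<in> S \<longleftrightarrow> (\<forall>\<^sub>F n in \<U>. y n \<in> W)"
  shows "dalg_hom (cring_class_ops :: 'f::real_normed_field ring) (smooth_dalg W)
    (star_ring \<U>) (star_smooth \<U> S) (\<lambda>c. star_cls \<U> (\<lambda>n. c)) (star_ext \<U> S)"
proof -
  have sub: "S \<subseteq> range (star_vec \<U>)" using S by (simp add: star_open_def)
  note eqI = extensional_eqI_star_vec[OF sub]
  have ext: "star_ext \<U> S f \<in> extensional S" for f :: "real^'n \<Rightarrow> 'f"
    by (simp add: star_ext_def)
  have rep: "internal_rep \<U> S (star_ext \<U> S f) (\<lambda>n. W) (\<lambda>n. f)" if "smooth_on W f" for f :: "real^'n \<Rightarrow> 'f"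
    using that W by (simp add: internal_rep_def S_iff star_ext_star_vec)
  have on_W: "star_ext \<U> S (restrict h W) (star_vec \<U> y) = star_cls \<U> (\<lambda>n. h (y n))"
    if "star_vec \<U> y \<in> S" for h :: "real^'n \<Rightarrow> 'f" and y
  proof -
    have "\<forall>\<^sub>F n in \<U>. restrict h W (y n) = h (y n)"
      using that unfolding S_iff by eventually_elim simp
    then show ?thesis using that by (simp add: star_ext_star_vec star_cls_eq_iff)
  qed
  show ?thesis
    unfolding dalg_hom_def
  proof (intro conjI ballI allI)
    show "(\<lambda>c. star_cls \<U> (\<lambda>n. c)) \<in> ring_hom (cring_class_ops :: 'f ring) (star_ring \<U>)"
      by (rule ring_hom_memI)
         (simp_all add: carrier_star_ring cring_class_ops_def star_cls_mult star_cls_add star_ring_one)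
    show "star_ext \<U> S \<in> ring_hom (smooth_dalg W) (star_smooth \<U> S :: ('f star, _, 'n) dalg)"
    proof (rule ring_hom_memI)
      fix f g :: "real^'n \<Rightarrow> 'f"
      assume f: "f \<in> carrier (smooth_dalg W)"
      then show "star_ext \<U> S f \<in> carrier (star_smooth \<U> S)"
        using ext rep[of f] S_iff
        by (auto simp: carrier_star_smooth_iff[OF free sub] smooth_dalg_ops)
      assume g: "g \<in> carrier (smooth_dalg W)"
      show "star_ext \<U> S (f \<otimes>\<^bsub>smooth_dalg W\<^esub> g) = star_ext \<U> S f \<otimes>\<^bsub>star_smooth \<U> S\<^esub> star_ext \<U> S g"
        by (rule eqI[OF ext]) (simp_all only: star_smooth_ops smooth_dalg_ops restrict_extensional on_W, simp add: star_ext_star_vec star_cls_mult)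
      show "star_ext \<U> S (f \<oplus>\<^bsub>smooth_dalg W\<^esub> g) = star_ext \<U> S f \<oplus>\<^bsub>star_smooth \<U> S\<^esub> star_ext \<U> S g"
        by (rule eqI[OF ext]) (simp_all only: star_smooth_ops smooth_dalg_ops restrict_extensional on_W, simp add: star_ext_star_vec star_cls_add)
    next
      show "star_ext \<U> S \<one>\<^bsub>smooth_dalg W\<^esub> = (\<one>\<^bsub>star_smooth \<U> S\<^esub> :: _ \<Rightarrow> 'f star)"
        by (rule eqI[OF ext]) (simp_all only: star_smooth_ops smooth_dalg_ops restrict_extensional on_W, simp add: star_ring_one)
    qed
  next
    fix c :: 'f and f :: "real^'n \<Rightarrow> 'f"
    show "star_ext \<U> S (c \<odot>\<^bsub>smooth_dalg W\<^esub> f) = star_cls \<U> (\<lambda>n. c) \<odot>\<^bsub>star_smooth \<U> S\<^esub> star_ext \<U> S f"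
      by (rule eqI[OF ext]) (simp_all only: star_smooth_ops smooth_dalg_ops restrict_extensional on_W, simp add: star_ext_star_vec star_cls_mult)
  next
    fix i and f :: "real^'n \<Rightarrow> 'f" assume "f \<in> carrier (smooth_dalg W)"
    then have f: "smooth_on W f" by (simp add: smooth_dalg_ops)
    show "star_ext \<U> S (pder (smooth_dalg W) i f) = pder (star_smooth \<U> S) i (star_ext \<U> S f)"
    proof (rule eqI[OF ext])
      fix y assume y: "star_vec \<U> y \<in> S"
      show "star_ext \<U> S (pder (smooth_dalg W) i f) (star_vec \<U> y)
          = pder (star_smooth \<U> S) i (star_ext \<U> S f) (star_vec \<U> y)"
        using star_partial_eq[OF free rep[OF f]] y
        by (simp only: star_smooth_ops smooth_dalg_ops on_W S_iff)
    qed (simp add: star_smooth_ops star_partial_def)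
  qed (use star_smooth_differential_algebra[OF free S] smooth_dalg_differential_algebra[OF W] in blast)+
qed

lemma openin_rho_ext: "open W \<Longrightarrow> openin (rho_topology \<U>) (rho_ext \<U> W)"
  unfolding rho_topology_def rho_ext_def by (rule topology_generated_by_Basis) auto

lemma star_preimage_rho_ext_iff:
  assumes "free_ultrafilter \<U>"
  shows "star_vec \<U> y \<in> star_preimage \<U> (rho_ext \<U> W) \<longleftrightarrow> (\<forall>\<^sub>F n in \<U>. y n \<in> W)"
proof -
  have "W \<noteq> {}" if "\<forall>\<^sub>F n in \<U>. y n \<in> W"
    using eventually_happens'[OF free_ultrafilter_not_bot[OF assms] that] by blast
  moreover have "star_vec \<U> y \<in> star_preimage \<U> (rho_ext \<U> W) \<longleftrightarrow> W \<noteq> {} \<and> (\<forall>\<^sub>F n in \<U>. y n \<in> W)"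
    by (simp add: star_preimage_eq[OF assms] rho_ext_def rho_box_iff[OF assms] rangeI)
  ultimately show ?thesis by blast
qed

text \<open>
  The natural extension followed by \<open>\<phi> \<mapsto> {\<phi>}\<close>.
\<close>

lemma rho_smooth_embedding:
  fixes W :: "(real^'n::{finite, linorder}) set"
  assumes free: "free_ultrafilter \<U>" and W: "open W"
  shows "\<exists>i\<^sub>W. dalg_hom (cring_class_ops :: 'f::real_normed_field ring) (smooth_dalg W)
                   (rho_ring \<U>) (rho_smooth \<U> (rho_ext \<U> W)) (rho_const \<U>) i\<^sub>W
             \<and> inj_on i\<^sub>W (carrier (smooth_dalg W))
             \<and> (\<forall>f\<in>carrier (smooth_dalg W). \<forall>\<phi>\<in>i\<^sub>W f. \<forall>x\<in>moderate_nets \<U> (\<lambda>n. W).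
                  rho_proj \<U> (\<phi> (star_vec \<U> x)) = rho_proj \<U> (star_cls \<U> (\<lambda>n. f (x n))))"
proof -
  let ?S = "star_preimage \<U> (rho_ext \<U> W)"
  note S = openin_rho_topology(1)[OF free openin_rho_ext[OF W]]
  note S_iff = star_preimage_rho_ext_iff[OF free]
  define i\<^sub>W where "i\<^sub>W = (\<lambda>f. {f}) \<circ> (star_ext \<U> ?S :: (real ^ 'n::{finite, linorder} \<Rightarrow> 'f) \<Rightarrow> _)"
  have const: "rho_const \<U> = (\<lambda>c. {c}) \<circ> (\<lambda>c :: 'f. star_cls \<U> (\<lambda>n. c))"
    by (auto simp: rho_const_def rho_proj_eq[OF free] carrier_star_ring)
  have "dalg_hom (cring_class_ops :: 'f ring) (smooth_dalg W)
      (rho_ring \<U>) (rho_smooth \<U> (rho_ext \<U> W)) (rho_const \<U>) i\<^sub>W"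
    unfolding const i\<^sub>W_def rho_ring_eq[OF free] rho_smooth_eq[OF free S]
    by (rule dalg_hom_compose[OF star_ext_dalg_hom[OF free W S S_iff]
          dalg_hom_quot_zero[OF star_smooth_differential_algebra[OF free S]]])
  moreover have "inj_on i\<^sub>W (carrier (smooth_dalg W))"
  proof (rule inj_onI)
    fix f g :: "real ^ 'n::{finite, linorder} \<Rightarrow> 'f"
    assume fg: "f \<in> carrier (smooth_dalg W)" "g \<in> carrier (smooth_dalg W)" and "i\<^sub>W f = i\<^sub>W g"
    then have eq: "star_ext \<U> ?S f = star_ext \<U> ?S g" by (simp add: i\<^sub>W_def)
    show "f = g"
    proof (rule extensionalityI[of _ W])
      fix x assume "x \<in> W"
      then have "star_vec \<U> (\<lambda>n. x) \<in> ?S" by (simp add: S_iff)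
      then have "star_cls \<U> (\<lambda>n. f x) = star_cls \<U> (\<lambda>n. g x)"
        using star_ext_star_vec[of \<U> "\<lambda>n. x" ?S f] star_ext_star_vec[of \<U> "\<lambda>n. x" ?S g] eq by simp
      then show "f x = g x"
        using free_ultrafilter_not_bot[OF free] by (simp add: star_cls_eq_iff)
    qed (use fg in \<open>simp_all add: smooth_dalg_ops\<close>)
  qed
  moreover have "\<forall>f\<in>carrier (smooth_dalg W). \<forall>\<phi>\<in>i\<^sub>W f. \<forall>x\<in>moderate_nets \<U> (\<lambda>n. W).
      rho_proj \<U> (\<phi> (star_vec \<U> x)) = rho_proj \<U> (star_cls \<U> (\<lambda>n. f (x n)))"
    by (auto simp: i\<^sub>W_def moderate_nets_eq[OF free] S_iff star_ext_star_vec)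
  ultimately show ?thesis by (intro exI[of _ i\<^sub>W] conjI)
qed

theorem proposition3p10:
  fixes \<U> :: "nat filter"
    and U :: "(real rho ^ 'n::{finite, linorder}) set"
    and A :: "('f::{real_normed_field, euclidean_space} rho,
               (real star ^ 'n::{finite, linorder} \<Rightarrow> 'f star) set, 'n) dalg"
  assumes "free_ultrafilter \<U>"
    and "openin (rho_topology \<U>) U"
    and "A = rho_smooth \<U> U"
  shows
    "(\<exists>\<iota>. \<iota> \<in> carrier A \<rightarrow> (U \<rightarrow>\<^sub>E carrier (rho_ring \<U> :: 'f rho ring))
        \<and> inj_on \<iota> (carrier A)
        \<and> (\<forall>\<Phi>\<in>carrier A. \<forall>\<phi>\<in>\<Phi>. \<forall>x\<in>star_preimage \<U> U.
             \<iota> \<Phi> (rho_proj_vec \<U> x) = rho_proj \<U> (\<phi> x)))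
     \<and> differential_algebra (rho_ring \<U> :: 'f rho ring) A
     \<and> (\<forall>W :: (real ^ 'n::{finite, linorder}) set. open W \<longrightarrow>
          (\<exists>i\<^sub>W. dalg_hom (cring_class_ops :: 'f ring) (smooth_dalg W)
                   (rho_ring \<U>) (rho_smooth \<U> (rho_ext \<U> W)) (rho_const \<U>) i\<^sub>W
             \<and> inj_on i\<^sub>W (carrier (smooth_dalg W))
             \<and> (\<forall>f\<in>carrier (smooth_dalg W). \<forall>\<phi>\<in>i\<^sub>W f. \<forall>x\<in>moderate_nets \<U> (\<lambda>n. W).
                  rho_proj \<U> (\<phi> (star_vec \<U> x)) = rho_proj \<U> (star_cls \<U> (\<lambda>n. f (x n))))))"
proof -
  note S = openin_rho_topology(1)[OF assms(1,2)]
  have "differential_algebra (rho_ring \<U> :: 'f rho ring) A"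
    using dalg_hom_quot_zero[OF star_smooth_differential_algebra[OF assms(1) S]]
    unfolding assms(3) rho_ring_eq[OF assms(1)] rho_smooth_eq[OF assms(1) S] dalg_hom_def
    by (elim conjE)
  show ?thesis
  proof (intro conjI allI impI, goal_cases)
    case 1
    show ?case by (rule rho_smooth_evaluation[OF assms])
  next
    case 2
    show ?case by fact
  next
    case (3 W)
    then show ?case by (rule rho_smooth_embedding[OF assms(1)])
  qed
qed

end
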